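(* Let $a_1,a_2,b_1,b_2,c_1,c_2,d_1\in\mathbb{C}$ with $\Re(c_1)>\Re(d_1)>0$ and $\Re(c_2)>\Re(b_2)>0$, and let $y,z\in\mathbb{C}$ with $|y|+|z|<1$. Then \[ F_{2}[a_1,b_1,b_2;c_1,c_2;y,z] =\int_{0}^{1}\int_{0}^{1}(1-wz-vy)^{-a_1}\, {}_{2}F_{1}\left[\begin{matrix} a_1-a_2,\; c_1-b_1-d_1\\ c_1-d_1\end{matrix};\frac{vy}{vy+wz-1}\right] {}_{2}F_{1}\left[\begin{matrix} a_2,\; b_1+d_1-c_1\\ d_1\end{matrix};\frac{(1-v)y}{1-vy-wz}\right] \mathrm{d}\mu_{c_1-d_1,\,d_1}(v)\,\mathrm{d}\mu_{b_2,\,c_2-b_2}(w). \]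
   Context: $(a)_n=a(a+1)\cdots(a+n-1)$, $(a)_0=1$, is the Pochhammer symbol. ${}_2F_1\left[\begin{matrix}\alpha,\beta\\ \gamma\end{matrix};\zeta\right]=\sum_{n\ge0}\frac{(\alpha)_n(\beta)_n}{(\gamma)_n}\frac{\zeta^n}{n!}$ for $|\zeta|<1$ is the Gauss hypergeometric function, extended by its principal analytic continuation to $\mathbb{C}\setminus[1,\infty)$. The Appell function $F_2$ is \[ F_2[a,b,b';c,c';y,z]=\sum_{m,n=0}^{\infty}\frac{(a)_{m+n}(b)_m(b')_n}{(c)_m(c')_n}\frac{y^m}{m!}\frac{z^n}{n!}\qquad(|y|+|z|<1). \] For $\min\{\Re(\alpha),\Re(\beta)\}>0$, the (complex) Dirichlet measure on $(0,1)$ is \[ \mathrm{d}\mu_{\alpha,\beta}(t)=\frac{\Gamma(\alpha+\beta)}{\Gamma(\alpha)\Gamma(\beta)}t^{\alpha-1}(1-t)^{\beta-1}\,\mathrm{d}t . \] Complex powers take principal values (note that $\Re(1-wz-vy)>0$ for $v,w\in[0,1]$). *)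

theory Defs
  imports "HOL-Complex_Analysis.Complex_Analysis"
begin

definition gauss_series :: "complex \<Rightarrow> complex \<Rightarrow> complex \<Rightarrow> complex \<Rightarrow> complex" where
  "gauss_series \<alpha> \<beta> \<gamma> \<zeta> =
     (\<Sum>n. pochhammer \<alpha> n * pochhammer \<beta> n / pochhammer \<gamma> n * (\<zeta> ^ n / fact n))"

definition cut_plane :: "complex set" where
  "cut_plane = - (complex_of_real ` {1..})"

text \<open>
  The principal branch is the holomorphic function on the cut plane extending the series. The cut
  plane is connected, so the choice operator is unambiguous there; values on the cut and for
  \<open>\<gamma>\<close> a non-positive integer are not meaningful.
\<close>

definition hyp2F1 :: "complex \<Rightarrow> complex \<Rightarrow> complex \<Rightarrow> complex \<Rightarrow> complex" where
  "hyp2F1 \<alpha> \<beta> \<gamma> =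
     (SOME f. f holomorphic_on cut_plane \<and> (\<forall>\<zeta>. norm \<zeta> < 1 \<longrightarrow> f \<zeta> = gauss_series \<alpha> \<beta> \<gamma> \<zeta>))"

definition appell_F2 ::
  "complex \<Rightarrow> complex \<Rightarrow> complex \<Rightarrow> complex \<Rightarrow> complex \<Rightarrow> complex \<Rightarrow> complex \<Rightarrow> complex" where
  "appell_F2 a b b' c c' y z =
     (\<Sum>\<^sub>\<infinity>(m, n)\<in>UNIV. pochhammer a (m + n) * pochhammer b m * pochhammer b' n
        / (pochhammer c m * pochhammer c' n) * (y ^ m / fact m) * (z ^ n / fact n))"

definition dirichlet_density :: "complex \<Rightarrow> complex \<Rightarrow> real \<Rightarrow> complex" where
  "dirichlet_density \<alpha> \<beta> t =
     Gamma (\<alpha> + \<beta>) / (Gamma \<alpha> * Gamma \<beta>)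
       * complex_of_real t powr (\<alpha> - 1) * complex_of_real (1 - t) powr (\<beta> - 1)"

text \<open>
  The Dirichlet measure is complex-valued, so it enters through its density against Lebesgue
  measure on \<open>(0, 1)\<close>.
\<close>

definition dirichlet_integral :: "complex \<Rightarrow> complex \<Rightarrow> (real \<Rightarrow> complex) \<Rightarrow> complex" where
  "dirichlet_integral \<alpha> \<beta> f = (LBINT t:{0<..<1}. f t * dirichlet_density \<alpha> \<beta> t)"

end

theory Submission
  imports Defs
begin

text \<open>
  For \<open>norm s + norm t < 1\<close> the double series
  \<open>\<Sum>\<^sub>n\<^sub>,\<^sub>k (a)\<^sub>n\<^sub>+\<^sub>k q\<^sub>n s\<^sup>n t\<^sup>k / (n! k!)\<close> can be summed over \<open>k\<close> first, which gives
  \<open>(1 - t) powr - a\<close> times a power series in \<open>s / (1 - t)\<close>, or along the diagonals \<open>n + k = m\<close>.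
  Comparing the two, with the Chu-Vandermonde sum, yields Pfaff's transformation for small arguments,
  and analytic continuation extends it to the unit disc. Pfaff turns the integrand in \<open>v\<close>, up to
  the factor \<open>(1 - w z) powr - a1\<close>, into that of Erdelyi's integral for
  \<open>F(a1, b1; c1; y / (1 - w z))\<close>; this integral is evaluated by expanding in powers of \<open>y / (1 - w z)\<close>,
  integrating termwise against the Dirichlet moments, and applying Vandermonde twice. Integrating
  the same double series over \<open>w\<close> gives the Appell function.

  The choice operator in \<^const>\<open>hyp2F1\<close> is only meaningful once a continuation to the cut plane is
  known to exist. Euler's integral provides one when \<open>Re b > 1\<close> and \<open>Re (c - b) > 1\<close>, and
  contiguous relations lower \<open>b\<close> and \<open>c\<close> by integers from there.
\<close>

section \<open>The binomial double series\<close>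

text \<open>Newton's binomial series with exponent -a: the sign in (-a choose n) = (-1)^n (a)_n / n!
  cancels the sign of (-t)^n.\<close>

lemma pochhammer_sums_powr:
  fixes a t :: complex
  assumes "norm t < 1"
  shows "(\<lambda>n. pochhammer a n / fact n * t ^ n) sums ((1 - t) powr (- a))"
proof -
  have "(\<lambda>n. ((- a) gchoose n) * (- t) ^ n) sums ((1 + - t) powr (- a))"
    by (rule gen_binomial_complex) (use assms in simp)
  moreover have "((- a) gchoose n) * (- t) ^ n = pochhammer a n / fact n * t ^ n" for n
  proof -
    have "(- t) ^ n = (- 1) ^ n * t ^ n"
      by (rule power_minus)
    moreover have "(- 1) ^ n * (- 1) ^ n = (1 :: complex)"
      by (simp flip: power_mult_distrib)
    ultimately show ?thesis
      by (simp add: gbinomial_pochhammer)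
  qed
  ultimately show ?thesis
    by simp
qed

lemma pochhammer_sums_powr_real:
  fixes a t :: real
  assumes "0 \<le> t" "t < 1"
  shows "(\<lambda>n. pochhammer a n / fact n * t ^ n) sums ((1 - t) powr (- a))"
proof -
  have "(\<lambda>n. pochhammer (complex_of_real a) n / fact n * of_real t ^ n) sums
          ((1 - of_real t) powr (- of_real a))"
    by (rule pochhammer_sums_powr) (use assms in simp)
  also have "(\<lambda>n. pochhammer (complex_of_real a) n / fact n * of_real t ^ n) =
      (\<lambda>n. complex_of_real (pochhammer a n / fact n * t ^ n))"
    by (simp add: pochhammer_of_real)
  also have "(1 - complex_of_real t) powr (- of_real a) = of_real ((1 - t) powr (- a))"
    using assms by (simp flip: powr_of_real)
  finally show ?thesis
    by (simp only: sums_of_real_iff)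
qed

section \<open>Growth bounds for Pochhammer symbols and their ratios\<close>

lemma pochhammer_nonneg_of_nonneg: "0 \<le> pochhammer a n" if "a \<ge> 0" for a :: real
  unfolding pochhammer_prod using that by (intro prod_nonneg) auto

lemma norm_pochhammer_le: "norm (pochhammer (a :: complex) n) \<le> pochhammer (norm a) n"
proof (induction n)
  case (Suc n)
  have "norm (a + of_nat n) \<le> norm a + of_nat n"
    using norm_triangle_ineq[of a "of_nat n"] by simp
  with Suc show ?case
    unfolding pochhammer_Suc norm_mult
    by (intro mult_mono) (auto intro: pochhammer_nonneg_of_nonneg)
qed simp

text \<open>Pochhammer ratios grow only polynomially, but this weaker bound is enough:
  \<open>norm s + norm t < 1\<close> leaves room to replace s by r s with some r > 1, and no sharp
  asymptotics are needed.\<close>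

definition subexponential :: "(nat \<Rightarrow> complex) \<Rightarrow> bool" where
  "subexponential q \<longleftrightarrow> (\<forall>r>1. \<exists>C\<ge>0. \<forall>n. norm (q n) \<le> C * r ^ n)"

lemma subexponentialE:
  assumes "subexponential q" "r > 1"
  obtains C where "C \<ge> 0" "\<And>n. norm (q n) \<le> C * r ^ n"
  using assms unfolding subexponential_def by blast

lemma pochhammer_series_abs_summable:
  fixes a t :: complex
  assumes "norm t < 1"
  shows "summable (\<lambda>n. norm (pochhammer a n / fact n * t ^ n))"
proof (rule summable_comparison_test')
  show "summable (\<lambda>n. pochhammer (norm a) n / fact n * norm t ^ n)"
    using pochhammer_sums_powr_real[of "norm t" "norm a"] assms by (simp add: sums_iff)
  show "norm (norm (pochhammer a n / fact n * t ^ n)) \<le> pochhammer (norm a) n / fact n * norm t ^ n" for n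
    by (auto simp: norm_mult norm_divide norm_power intro!: mult_right_mono divide_right_mono norm_pochhammer_le)
qed

lemma pochhammer_nonzero_of_Re_pos: "Re c > 0 \<Longrightarrow> pochhammer c n \<noteq> 0"
  by (auto simp: pochhammer_eq_0_iff)

text \<open>The quotient of consecutive ratios has norm tending to 1, hence is below r from some N
  on. After division by r^n the sequence is nonincreasing in norm beyond N, so the first terms up to
  N bound it.\<close>

lemma subexponential_pochhammer_ratio:
  assumes "Re c > 0"
  shows "subexponential (\<lambda>n. pochhammer b n / pochhammer c n)"
  unfolding subexponential_def
proof (intro allI impI)
  fix r :: real assume r: "r > 1"
  define f where "f = (\<lambda>n. pochhammer b n / pochhammer c n * of_real (1 / r) ^ n)"
  have "(\<lambda>n. norm (b + of_nat n) / norm (c + of_nat n)) \<longlonglongrightarrow> 1"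
  proof -
    have *: "(\<lambda>n. x / of_nat n) \<longlonglongrightarrow> 0" for x :: complex
      by (rule lim_const_over_n)
    have "(\<lambda>n. norm ((b / of_nat n + 1) / (c / of_nat n + 1))) \<longlonglongrightarrow> norm ((0 + 1) / (0 + 1 :: complex))"
      by (intro tendsto_intros *) auto
    moreover have "eventually (\<lambda>n. norm ((b / of_nat n + 1) / (c / of_nat n + 1)) =
        norm (b + of_nat n) / norm (c + of_nat n)) sequentially"
      using eventually_gt_at_top[of 0]
    proof eventually_elim
      case (elim n)
      have "(b / of_nat n + 1) / (c / of_nat n + 1) = (b + of_nat n) / (c + of_nat n)"
      proof -
        have "x / of_nat n + 1 = (x + of_nat n) / of_nat n" for x :: complex
          using elim by (simp add: add_divide_distrib)
        thus ?thesis
          using elim by simp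
      qed
      thus ?case
        by (simp add: norm_divide)
    qed
    ultimately show ?thesis
      by (simp add: filterlim_cong)
  qed
  hence "eventually (\<lambda>n. norm (b + of_nat n) / norm (c + of_nat n) < r) sequentially"
    using r by (rule order_tendstoD)
  then obtain N where N: "\<And>n. n \<ge> N \<Longrightarrow> norm (b + of_nat n) / norm (c + of_nat n) < r"
    by (auto simp: eventually_at_top_linorder)
  have step: "norm (f (Suc n)) \<le> norm (f n)" if "n \<ge> N" for n
  proof -
    have "norm (f (Suc n)) = norm (f n) * ((norm (b + of_nat n) / norm (c + of_nat n)) / r)"
      using r by (simp add: f_def pochhammer_Suc norm_mult norm_divide norm_power mult_ac)
    also have "\<dots> \<le> norm (f n) * 1"
    proof (rule mult_left_mono)
      show "norm (b + of_nat n) / norm (c + of_nat n) / r \<le> 1"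
        using N[OF that] r by (subst divide_le_eq_1_pos) auto
    qed simp
    finally show ?thesis by simp
  qed
  have "norm (f n) \<le> norm (f N)" if "n \<ge> N" for n
    using that by (induction n rule: dec_induct) (use step order_trans in auto)
  hence "norm (f n) \<le> (\<Sum>i\<le>N. norm (f i))" for n
  proof (cases "n \<le> N")
    case True
    thus ?thesis by (intro member_le_sum) auto
  next
    case False
    have "norm (f n) \<le> norm (f N)"
      using False \<open>\<And>n. n \<ge> N \<Longrightarrow> norm (f n) \<le> norm (f N)\<close> by simp
    also have "\<dots> \<le> (\<Sum>i\<le>N. norm (f i))"
      by (intro member_le_sum) auto
    finally show ?thesis .
  qed
  moreover have "norm (pochhammer b n / pochhammer c n) = norm (f n) * r ^ n" for n
    using r by (simp add: f_def norm_mult norm_divide norm_power power_divide)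
  ultimately have "norm (pochhammer b n / pochhammer c n) \<le> (\<Sum>i\<le>N. norm (f i)) * r ^ n" for n
    using r by (simp add: mult_right_mono)
  thus "\<exists>C\<ge>0. \<forall>n. norm (pochhammer b n / pochhammer c n) \<le> C * r ^ n"
    by (intro exI[of _ "\<Sum>i\<le>N. norm (f i)"]) (auto intro: sum_nonneg)
qed

section \<open>Convergence, row sums and diagonal sums of the double series\<close>

definition binomial_double_term ::
    "complex \<Rightarrow> (nat \<Rightarrow> complex) \<Rightarrow> complex \<Rightarrow> complex \<Rightarrow> nat \<times> nat \<Rightarrow> complex" where
  "binomial_double_term a q s t =
     (\<lambda>(n, k). pochhammer a (n + k) * q n * (s ^ n / fact n) * (t ^ k / fact k))"

text \<open>Since (a)_(n+k) = (a)_n (a+n)_k, row n is a binomial series with exponent -(a+n). Its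
  extra factor (1-t)^(-n) combines with s^n.\<close>

lemma binomial_double_row_sums:
  fixes a :: complex
  assumes "norm t < 1"
  shows "(\<lambda>k. binomial_double_term a q s t (n, k)) sums
           ((1 - t) powr (- a) * (pochhammer a n * q n / fact n * (s / (1 - t)) ^ n))"
proof -
  have t: "1 - t \<noteq> 0" using assms by auto
  have "(1 - t) powr (- (a + of_nat n)) = (1 - t) powr (- a) / (1 - t) ^ n"
  proof -
    have "(1 - t) powr (- (a + of_nat n)) = (1 - t) powr (- a - of_nat n)"
      by simp
    also have "\<dots> = (1 - t) powr (- a) / (1 - t) ^ n"
      using t by (simp only: powr_diff) (simp add: powr_nat')
    finally show ?thesis .
  qed
  with sums_mult[OF pochhammer_sums_powr[OF assms, of "a + of_nat n"],
      of "pochhammer a n * q n * (s ^ n / fact n)"]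
  show ?thesis
    by (simp add: binomial_double_term_def pochhammer_product' power_divide mult_ac)
qed

lemma binomial_double_row_sums_real:
  fixes a s t :: real
  assumes "0 \<le> t" "t < 1"
  shows "(\<lambda>k. pochhammer a (n + k) * (s ^ n / fact n) * (t ^ k / fact k)) sums
           ((1 - t) powr (- a) * (pochhammer a n / fact n * (s / (1 - t)) ^ n))"
proof -
  have "(1 - t) powr (- (a + of_nat n)) = (1 - t) powr (- a) / (1 - t) ^ n"
    using assms powr_diff[of "1 - t" "- a" "of_nat n"] by (simp add: powr_realpow)
  with sums_mult[OF pochhammer_sums_powr_real[OF assms, of "a + of_nat n"],
      of "pochhammer a n * (s ^ n / fact n)"]
  show ?thesis
    by (simp add: pochhammer_product' power_divide mult_ac)
qed

text \<open>All terms are nonnegative, so it suffices that the rows converge and that their sums do.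
  The row sums form a binomial series in s/(1-t), which is below 1 because s + t < 1.\<close>

lemma binomial_double_summable_real:
  fixes a s t :: real
  assumes "0 \<le> a" "0 \<le> s" "0 \<le> t" "s + t < 1"
  shows "(\<lambda>(n, k). pochhammer a (n + k) * (s ^ n / fact n) * (t ^ k / fact k)) summable_on UNIV"
proof -
  have nn: "0 \<le> pochhammer a m" for m
    using assms(1) by (rule pochhammer_nonneg_of_nonneg)
  let ?g = "\<lambda>n. (1 - t) powr (- a) * (pochhammer a n / fact n * (s / (1 - t)) ^ n)"
  have "(\<lambda>p. case p of (n, k) \<Rightarrow> pochhammer a (n + k) * (s ^ n / fact n) * (t ^ k / fact k))
          summable_on (Sigma UNIV (\<lambda>_. UNIV))"
  proof (rule summable_on_SigmaI)
    fix n :: nat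
    show "((\<lambda>k. case (n, k) of (n, k) \<Rightarrow> pochhammer a (n + k) * (s ^ n / fact n) * (t ^ k / fact k))
            has_sum ?g n) UNIV"
      using binomial_double_row_sums_real[of t a n s] assms nn
      by (intro sums_nonneg_imp_has_sum) auto
  next
    have "summable ?g"
      by (intro summable_mult sums_summable[OF pochhammer_sums_powr_real])
         (use assms in \<open>auto simp: field_simps\<close>)
    thus "?g summable_on UNIV"
      using assms nn by (subst summable_on_UNIV_nonneg_real_iff) auto
  qed (use nn assms in auto)
  thus ?thesis by simp
qed

lemma ex_scaling_gt_1:
  fixes s t :: real
  assumes "s + t < 1"
  shows "\<exists>r>1. r * s + t < 1"
proof -
  have "((\<lambda>r. r * s + t) \<longlongrightarrow> 1 * s + t) (at_right 1)"
    by (intro tendsto_intros)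
  hence "eventually (\<lambda>r. r * s + t < 1) (at_right (1 :: real))"
    using assms by (intro order_tendstoD) auto
  hence "eventually (\<lambda>r. r > 1 \<and> r * s + t < 1) (at_right (1 :: real))"
    by (intro eventually_conj eventually_at_right_less)
  thus ?thesis
    using eventually_happens'[of "at_right (1 :: real)"] by fastforce
qed

lemma infsum_rows_sums:
  fixes f :: "nat \<times> nat \<Rightarrow> 'a :: banach"
  assumes "f summable_on UNIV"
  shows "(\<lambda>n. infsum (\<lambda>k. f (n, k)) UNIV) sums infsum f UNIV"
proof -
  have sm: "f summable_on (Sigma UNIV (\<lambda>_. UNIV))"
    using assms by simp
  have "(\<lambda>n. infsum (\<lambda>k. f (n, k)) UNIV) summable_on UNIV"
    by (rule summable_on_Sigma_banach) (use sm in simp)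
  hence "(\<lambda>n. infsum (\<lambda>k. f (n, k)) UNIV) sums infsum (\<lambda>n. infsum (\<lambda>k. f (n, k)) UNIV) UNIV"
    by (intro has_sum_imp_sums has_sum_infsum)
  also have "infsum (\<lambda>n. infsum (\<lambda>k. f (n, k)) UNIV) UNIV = infsum f UNIV"
    using infsum_Sigma_banach[OF sm] by simp
  finally show ?thesis .
qed

lemma infsum_columns_sums:
  fixes f :: "nat \<times> nat \<Rightarrow> 'a :: banach"
  assumes "f summable_on UNIV"
  shows "(\<lambda>k. infsum (\<lambda>n. f (n, k)) UNIV) sums infsum f UNIV"
proof -
  have bij: "bij_betw prod.swap UNIV (UNIV :: (nat \<times> nat) set)"
    by (rule bij_swap)
  have "(\<lambda>p. f (prod.swap p)) summable_on UNIV"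
    using summable_on_reindex_bij_betw[OF bij, of f] assms by simp
  from infsum_rows_sums[OF this] show ?thesis
    using infsum_reindex_bij_betw[OF bij, of f] by simp
qed

text \<open>The bound \<open>C * r ^ n\<close> on q is absorbed into s: the majorant is the real
  double series with parameters \<open>norm a\<close>, \<open>r * norm s\<close> and
  \<open>norm t\<close>, where r > 1 is so close to 1 that it still converges.\<close>

lemma binomial_double_abs_summable:
  assumes q: "subexponential q" and st: "norm s + norm t < 1"
  shows "(\<lambda>p. norm (binomial_double_term a q s t p)) summable_on UNIV"
proof -
  obtain r where r: "r > 1" "r * norm s + norm t < 1"
    using ex_scaling_gt_1[OF st] by blast
  obtain C where C: "C \<ge> 0" "\<And>n. norm (q n) \<le> C * r ^ n"
    using subexponentialE[OF q r(1)] by blast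
  let ?h = "\<lambda>(n, k). pochhammer (norm a) (n + k) * ((r * norm s) ^ n / fact n) * (norm t ^ k / fact k)"
  have "?h summable_on UNIV"
    by (rule binomial_double_summable_real) (use r in auto)
  hence *: "(\<lambda>p. C * ?h p) summable_on UNIV"
    by (rule summable_on_cmult_right)
  show ?thesis
  proof (rule summable_on_comparison_test[OF *])
    fix p :: "nat \<times> nat"
    obtain n k where p: "p = (n, k)" by force
    have "norm (pochhammer a (n + k)) * norm (q n) * (norm s ^ n / fact n) * (norm t ^ k / fact k) \<le>
      pochhammer (norm a) (n + k) * (C * r ^ n) * (norm s ^ n / fact n) * (norm t ^ k / fact k)"
      by (intro mult_right_mono mult_mono norm_pochhammer_le C)
         (auto intro: order_trans[OF norm_ge_zero norm_pochhammer_le])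
    thus "norm (binomial_double_term a q s t p) \<le> C * ?h p"
      by (simp add: p binomial_double_term_def norm_mult norm_divide norm_power power_mult_distrib mult_ac)
  qed auto
qed

lemma binomial_double_row_form:
  assumes q: "subexponential q" and st: "norm s + norm t < 1"
  shows "(\<lambda>n. (1 - t) powr (- a) * (pochhammer a n * q n / fact n * (s / (1 - t)) ^ n)) sums
           infsum (binomial_double_term a q s t) UNIV"
proof -
  let ?f = "binomial_double_term a q s t"
  have t: "norm t < 1"
    using st by (smt (verit) norm_ge_zero)
  have sm: "?f summable_on UNIV"
    using binomial_double_abs_summable[OF assms, of a] by (simp add: abs_summable_summable)
  have row: "infsum (\<lambda>k. ?f (n, k)) UNIV =
      (1 - t) powr (- a) * (pochhammer a n * q n / fact n * (s / (1 - t)) ^ n)" for n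
  proof -
    have "(\<lambda>k. ?f (n, k)) summable_on UNIV"
      using summable_on_SigmaD1[of "\<lambda>n k. ?f (n, k)" UNIV "\<lambda>_. UNIV" n] sm by simp
    hence "(\<lambda>k. ?f (n, k)) sums infsum (\<lambda>k. ?f (n, k)) UNIV"
      by (intro has_sum_imp_sums has_sum_infsum)
    thus ?thesis
      using binomial_double_row_sums[OF t] sums_unique2 by blast
  qed
  show ?thesis
    using infsum_rows_sums[OF sm] by (simp only: row)
qed

text \<open>On the diagonal n + k = m the Pochhammer factor is constant and 1/(n! k!) = (m choose
  n)/m!. Absolute convergence permits the regrouping.\<close>

lemma binomial_double_diagonal_form:
  assumes q: "subexponential q" and st: "norm s + norm t < 1"
  shows "(\<lambda>m. pochhammer a m / fact m * (\<Sum>n\<le>m. of_nat (m choose n) * q n * s ^ n * t ^ (m - n))) sums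
           infsum (binomial_double_term a q s t) UNIV"
proof -
  let ?f = "binomial_double_term a q s t"
  let ?g = "\<lambda>m n. ?f (n, m - n)"
  have f: "?f summable_on UNIV"
    using binomial_double_abs_summable[OF assms, of a] by (simp add: abs_summable_summable)
  have bij: "bij_betw (\<lambda>(m, n). (n, m - n)) (SIGMA m:UNIV. {..m}) (UNIV :: (nat \<times> nat) set)"
    by (rule bij_betwI[where g = "\<lambda>(n, k). (n + k, n)"]) auto
  have sm: "(\<lambda>(m, n). ?g m n) summable_on (SIGMA m:UNIV. {..m})"
    using summable_on_reindex_bij_betw[OF bij, of ?f] f by (simp add: case_prod_unfold)
  have "infsum (\<lambda>m. infsum (?g m) {..m}) UNIV = infsum (\<lambda>(m, n). ?g m n) (SIGMA m:UNIV. {..m})"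
    by (rule infsum_Sigma'_banach[OF sm])
  also have "\<dots> = infsum ?f UNIV"
    using infsum_reindex_bij_betw[OF bij, of ?f] by (simp add: case_prod_unfold)
  finally have "infsum (\<lambda>m. infsum (?g m) {..m}) UNIV = infsum ?f UNIV" .
  hence "(\<lambda>m. infsum (?g m) {..m}) sums infsum ?f UNIV"
    using has_sum_imp_sums[OF has_sum_infsum[OF summable_on_Sigma_banach[OF sm]]] by simp
  moreover have "infsum (?g m) {..m} =
      pochhammer a m / fact m * (\<Sum>n\<le>m. of_nat (m choose n) * q n * s ^ n * t ^ (m - n))" for m
  proof -
    have "?g m n = pochhammer a m / fact m * (of_nat (m choose n) * q n * s ^ n * t ^ (m - n))"
      if "n \<le> m" for n
      using that by (simp add: binomial_double_term_def binomial_fact)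
    thus ?thesis
      by (simp add: sum_distrib_left)
  qed
  ultimately show ?thesis by simp
qed

section \<open>Complex Beta integral and Dirichlet moments\<close>

lemma not_nonpos_Int_of_Re_pos: "Re c > 0 \<Longrightarrow> c \<notin> \<int>\<^sub>\<le>\<^sub>0"
  by (auto elim!: nonpos_Ints_cases)

lemma Gamma_nonzero_of_Re_pos: "Re c > 0 \<Longrightarrow> Gamma c \<noteq> 0"
  by (simp add: Gamma_eq_zero_iff not_nonpos_Int_of_Re_pos)

text \<open>Passes from the completed measure to \<open>lborel\<close>. The indicator is kept inside
  the integrand so that translates can be integrated over the whole line.\<close>

lemma integrable_Gamma_integrand:
  assumes "Re a > 0"
  shows "integrable lborel (\<lambda>t. indicator {0<..} t *\<^sub>R (complex_of_real t powr (a - 1) / of_real (exp t)))"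
    and "(LBINT t. indicator {0<..} t *\<^sub>R (complex_of_real t powr (a - 1) / of_real (exp t))) = Gamma a"
proof -
  have 1: "set_integrable lebesgue {0<..} (\<lambda>t. complex_of_real t powr (a - 1) / of_real (exp t))"
    using absolutely_integrable_Gamma_integral'[OF assms] .
  have m: "(\<lambda>t. indicator {0<..} t *\<^sub>R (complex_of_real t powr (a - 1) / of_real (exp t))) \<in> borel_measurable lborel"
    by measurable
  show "integrable lborel (\<lambda>t. indicator {0<..} t *\<^sub>R (complex_of_real t powr (a - 1) / of_real (exp t)))"
    using 1 integrable_completion[OF m] by (simp add: set_integrable_def)
  have "(LINT t:{0<..}|lebesgue. complex_of_real t powr (a - 1) / of_real (exp t)) = Gamma a"
    using set_lebesgue_integral_eq_integral(2)[OF 1] Gamma_integral_complex'[OF assms]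
    by (simp add: integral_unique)
  thus "(LBINT t. indicator {0<..} t *\<^sub>R (complex_of_real t powr (a - 1) / of_real (exp t))) = Gamma a"
    using integral_completion[OF m] by (simp add: set_lebesgue_integral_def)
qed

lemma integrable_Beta_complex:
  fixes a b :: complex
  assumes "Re a > 0" "Re b > 0"
  shows "set_integrable lborel {0<..<1} (\<lambda>t. complex_of_real t powr (a - 1) * of_real (1 - t) powr (b - 1))"
proof -
  have "set_integrable lborel {0<..<1::real} (\<lambda>t. t powr (Re a - 1) * (1 - t) powr (Re b - 1))"
    by (rule set_integrable_subset[OF integrable_Beta]) (use assms in auto)
  thus ?thesis
    unfolding set_integrable_def
  proof (rule Bochner_Integration.integrable_bound)
    show "AE t in lborel. norm (indicator {0<..<1} t *\<^sub>R (complex_of_real t powr (a - 1) * of_real (1 - t) powr (b - 1)))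
       \<le> norm (indicator {0<..<1} t *\<^sub>R (t powr (Re a - 1) * (1 - t) powr (Re b - 1)))"
      by (intro AE_I2) (auto simp: indicator_def norm_mult norm_powr_real_powr simp del: of_real_diff)
  qed measurable
qed

text \<open>The classical convolution argument: \<Gamma>(a) \<Gamma>(b) is the integral over u of
  the convolution of the two Gamma integrands, and that convolution is the Gamma integrand for a + b
  times the Beta integral.\<close>

theorem integral_Beta_complex:
  fixes a b :: complex
  assumes a: "Re a > 0" and b: "Re b > 0"
  shows "(LBINT t:{0<..<1}. complex_of_real t powr (a - 1) * of_real (1 - t) powr (b - 1)) = Beta a b"
proof -
  define F :: "complex \<Rightarrow> real \<Rightarrow> complex" where
    "F = (\<lambda>a t. indicator {0<..} t *\<^sub>R (complex_of_real t powr (a - 1) / of_real (exp t)))"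
  define I where "I = (LBINT t:{0<..<1}. complex_of_real t powr (a - 1) * of_real (1 - t) powr (b - 1))"
  have F_meas [measurable]: "F c \<in> borel_measurable borel" for c
    unfolding F_def by measurable
  have F_int: "integrable lborel (F c)" "integral\<^sup>L lborel (F c) = Gamma c" if "Re c > 0" for c
    using integrable_Gamma_integrand[OF that] unfolding F_def by auto
  have shift_int: "integrable lborel (\<lambda>u. F b (u - t))" for t
    using lborel_integrable_real_affine[OF F_int(1)[OF b], of 1 "-t"] by (simp add: algebra_simps)
  have shift: "(LBINT u. g (u - t)) = integral\<^sup>L lborel g" for t and g :: "real \<Rightarrow> 'z :: {banach, second_countable_topology}"
    using lborel_integral_real_affine[of 1 g "-t"] by (simp add: algebra_simps)
  \<comment> \<open>By translation invariance the inner integral of the norm is a constant multiple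
    of \<open>norm (F a t)\<close>, which is integrable.\<close>
  have "integrable (lborel \<Otimes>\<^sub>M lborel) (\<lambda>(t, u). F a t * F b (u - t))"
  proof (rule lborel_pair.Fubini_integrable)
    have "(LBINT u. norm (F a t * F b (u - t))) = norm (F a t) * (LBINT u. norm (F b u))" for t
      using shift[of "\<lambda>u. norm (F b u)" t] by (simp add: norm_mult)
    thus "integrable lborel (\<lambda>t. LBINT u. norm (case (t, u) of (t, u) \<Rightarrow> F a t * F b (u - t)))"
      using F_int(1)[OF a] by simp
  qed (use shift_int in auto)
  from lborel_pair.Fubini_integral[OF this]
  have "(LBINT u. LBINT t. F a t * F b (u - t)) = (LBINT t. LBINT u. F a t * F b (u - t))" .
  also have "\<dots> = Gamma a * Gamma b"
    using F_int(2)[OF a] F_int(2)[OF b] by (simp add: shift)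
  finally have 1: "(LBINT u. LBINT t. F a t * F b (u - t)) = Gamma a * Gamma b" .
  have "(LBINT t. F a t * F b (u - t)) = F (a + b) u * I" for u
  proof (cases "u > 0")
    case False
    hence "F a t * F b (u - t) = 0" for t
      by (auto simp: F_def indicator_def)
    moreover have "F (a + b) u = 0"
      using False by (simp add: F_def)
    ultimately show ?thesis
      by (simp only: integral_zero mult_zero_left)
  next
    \<comment> \<open>The substitution t = u s maps the support 0 < t < u onto 0 < s < 1. The two
      powers contribute u^(a+b-2), and the Jacobian u supplies the missing factor for
      u^(a+b-1).\<close>
    case u: True
    have *: "F a (u * s) * F b (u - u * s) = of_real u powr (a + b - 2) / of_real (exp u) *
        (indicator {0<..<1} s *\<^sub>R (complex_of_real s powr (a - 1) * of_real (1 - s) powr (b - 1)))" for s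
    proof (cases "0 < s \<and> s < 1")
      case False
      hence "u * s \<le> 0 \<or> u - u * s \<le> 0"
        using u by (auto simp: mult_le_0_iff not_less)
      thus ?thesis
        using False by (auto simp: F_def)
    next
      case True
      have pos: "u * s > 0" "u - u * s > 0"
        using u True by (auto simp: algebra_simps)
      have eq: "u - u * s = u * (1 - s)"
        by (simp add: algebra_simps)
      have p1: "complex_of_real (u * s) powr (a - 1) = of_real u powr (a - 1) * of_real s powr (a - 1)"
        using u True by (simp add: powr_times_real)
      have p2: "complex_of_real (u - u * s) powr (b - 1) = of_real u powr (b - 1) * of_real (1 - s) powr (b - 1)"
        unfolding eq of_real_mult by (rule powr_times_real) (use u True in auto)
      have p3: "complex_of_real u powr (a + b - 2) = of_real u powr (a - 1) * of_real u powr (b - 1)"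
        by (simp flip: powr_add)
      have "complex_of_real (exp u) = of_real (exp (u * s)) * of_real (exp (u - u * s))"
        by (simp flip: of_real_mult exp_add)
      thus ?thesis
        using pos True unfolding F_def p1 p2 p3 by (simp add: divide_simps)
    qed
    have "(LBINT t. F a t * F b (u - t)) = \<bar>u\<bar> *\<^sub>R (LBINT s. F a (0 + u * s) * F b (u - (0 + u * s)))"
      by (rule lborel_integral_real_affine) (use u in auto)
    also have "\<dots> = of_real u * (of_real u powr (a + b - 2) / of_real (exp u) * I)"
      using u by (simp add: * I_def set_lebesgue_integral_def scaleR_conv_of_real del: of_real_diff)
    also have "of_real u * of_real u powr (a + b - 2) = complex_of_real u powr (a + b - 1)"
      using u powr_add[of "complex_of_real u" 1 "a + b - 2"] by simp
    hence "of_real u * (of_real u powr (a + b - 2) / of_real (exp u) * I) =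
        complex_of_real u powr (a + b - 1) / of_real (exp u) * I"
      by (metis mult.assoc times_divide_eq_right)
    also have "\<dots> = F (a + b) u * I"
      using u by (simp add: F_def)
    finally show ?thesis .
  qed
  hence "Gamma a * Gamma b = Gamma (a + b) * I"
    using 1 F_int(2)[of "a + b"] a b by simp
  moreover have "Gamma (a + b) \<noteq> 0"
    using a b by (intro Gamma_nonzero_of_Re_pos) simp
  ultimately show ?thesis
    by (simp add: Beta_def I_def field_simps)
qed

section \<open>Integration against the Dirichlet density\<close>

lemma dirichlet_integrable:
  assumes a: "Re a > 0" and b: "Re b > 0"
    and f [measurable]: "f \<in> borel_measurable borel" and B: "\<And>t. t \<in> {0<..<1} \<Longrightarrow> norm (f t) \<le> B"
  shows "set_integrable lborel {0<..<1} (\<lambda>t. f t * dirichlet_density a b t)"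
proof -
  have d [measurable]: "dirichlet_density a b \<in> borel_measurable borel"
    unfolding dirichlet_density_def by measurable
  have d': "set_integrable lborel {0<..<1} (dirichlet_density a b)"
    using set_integrable_mult_right[OF integrable_Beta_complex[OF a b], of "Gamma (a + b) / (Gamma a * Gamma b)"]
    unfolding dirichlet_density_def by (simp add: mult.assoc)
  have "integrable lborel (\<lambda>t. B *\<^sub>R (indicator {0<..<1} t *\<^sub>R dirichlet_density a b t))"
    using d' unfolding set_integrable_def by (intro integrable_scaleR_right) auto
  thus ?thesis
    unfolding set_integrable_def
  proof (rule Bochner_Integration.integrable_bound)
    have "norm (f t) * norm (dirichlet_density a b t) \<le> \<bar>B\<bar> * norm (dirichlet_density a b t)"
      if "t \<in> {0<..<1}" for t
      using B[OF that] by (intro mult_right_mono) auto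
    thus "AE t in lborel. norm (indicator {0<..<1} t *\<^sub>R (f t * dirichlet_density a b t))
        \<le> norm (B *\<^sub>R (indicator {0<..<1} t *\<^sub>R dirichlet_density a b t))"
      by (intro AE_I2) (auto simp: indicator_def norm_mult)
  qed measurable
qed

lemma dirichlet_integral_cong:
  assumes "\<And>t. 0 < t \<Longrightarrow> t < 1 \<Longrightarrow> f t = g t"
  shows "dirichlet_integral a b f = dirichlet_integral a b g"
  unfolding dirichlet_integral_def using assms by (intro set_lebesgue_integral_cong) auto

lemma dirichlet_integral_cmult:
  "dirichlet_integral a b (\<lambda>t. c * f t) = c * dirichlet_integral a b f"
  unfolding dirichlet_integral_def by (simp add: mult.assoc)

text \<open>Multiplying by t^i (1-t)^j only shifts the parameters of the Beta integral to a + i and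
  b + j. The resulting Gamma quotients are Pochhammer symbols.\<close>

lemma dirichlet_integral_moment:
  assumes a: "Re a > 0" and b: "Re b > 0"
  shows "dirichlet_integral a b (\<lambda>t. of_real t ^ i * of_real (1 - t) ^ j) =
           pochhammer a i * pochhammer b j / pochhammer (a + b) (i + j)"
proof -
  let ?C = "Gamma (a + b) / (Gamma a * Gamma b)"
  have "dirichlet_integral a b (\<lambda>t. of_real t ^ i * of_real (1 - t) ^ j) =
    (LBINT t:{0<..<1}. ?C * (complex_of_real t powr (a + of_nat i - 1) * of_real (1 - t) powr (b + of_nat j - 1)))"
    unfolding dirichlet_integral_def
  proof (rule set_lebesgue_integral_cong)
    have *: "complex_of_real s ^ k * of_real s powr (c - 1) = of_real s powr (c + of_nat k - 1)"
      if "s > 0" for s k c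
      using that powr_add[of "complex_of_real s" "of_nat k" "c - 1"] by (simp add: add_ac add_diff_eq)
    show "\<forall>t. t \<in> {0<..<1} \<longrightarrow> of_real t ^ i * of_real (1 - t) ^ j * dirichlet_density a b t =
       ?C * (complex_of_real t powr (a + of_nat i - 1) * of_real (1 - t) powr (b + of_nat j - 1))"
    proof (intro allI impI)
      fix t :: real assume "t \<in> {0<..<1}"
      hence t: "t > 0" "1 - t > 0" by auto
      show "of_real t ^ i * of_real (1 - t) ^ j * dirichlet_density a b t =
       ?C * (complex_of_real t powr (a + of_nat i - 1) * of_real (1 - t) powr (b + of_nat j - 1))"
        unfolding dirichlet_density_def *[OF t(1), symmetric] *[OF t(2), symmetric]
        by (simp only: mult_ac)
    qed
  qed simp
  also have "\<dots> = ?C * Beta (a + of_nat i) (b + of_nat j)"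
    using a b by (simp add: integral_Beta_complex del: of_real_diff)
  also have "\<dots> = pochhammer a i * pochhammer b j / pochhammer (a + b) (i + j)"
  proof -
    have P: "pochhammer c k = Gamma (c + of_nat k) / Gamma c" if "Re c > 0" for c :: complex and k
      using that by (intro pochhammer_Gamma not_nonpos_Int_of_Re_pos)
    have "Re (a + b) > 0"
      using a b by simp
    moreover have "a + of_nat i + (b + of_nat j) = a + b + of_nat (i + j)"
      by simp
    ultimately show ?thesis
      using Gamma_nonzero_of_Re_pos[of "a + b"] by (simp only: P[OF a] P[OF b] P Beta_def) simp
  qed
  finally show ?thesis .
qed

lemma dirichlet_integral_sum:
  assumes a: "Re a > 0" and b: "Re b > 0"
    and f: "\<And>i. i \<in> A \<Longrightarrow> f i \<in> borel_measurable borel"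
    and B: "\<And>i t. i \<in> A \<Longrightarrow> t \<in> {0<..<1} \<Longrightarrow> norm (f i t) \<le> B i"
  shows "dirichlet_integral a b (\<lambda>t. \<Sum>i\<in>A. f i t) = (\<Sum>i\<in>A. dirichlet_integral a b (f i))"
  unfolding dirichlet_integral_def sum_distrib_right set_lebesgue_integral_def scaleR_sum_right
proof (rule Bochner_Integration.integral_sum)
  fix i assume i: "i \<in> A"
  show "integrable lborel (\<lambda>t. indicat_real {0<..<1} t *\<^sub>R (f i t * dirichlet_density a b t))"
    using dirichlet_integrable[OF a b f[OF i] B[OF i]] by (simp add: set_integrable_def)
qed

text \<open>A Weierstrass M-test for termwise integration: the density is integrable, with finite
  total variation \<open>K\<close>, so the integrals of the norms are dominated by
  \<open>B n * K\<close>.\<close>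

lemma dirichlet_integral_sums:
  assumes a: "Re a > 0" and b: "Re b > 0"
    and f [measurable]: "\<And>n. f n \<in> borel_measurable borel"
    and B: "\<And>n t. t \<in> {0<..<1} \<Longrightarrow> norm (f n t) \<le> B n" and "summable B"
    and g: "\<And>t. t \<in> {0<..<1} \<Longrightarrow> (\<lambda>n. f n t) sums g t"
  shows "(\<lambda>n. dirichlet_integral a b (f n)) sums dirichlet_integral a b g"
proof -
  let ?d = "dirichlet_density a b"
  let ?h = "\<lambda>n t. indicator {0<..<1} t *\<^sub>R (f n t * ?d t)"
  have d [measurable]: "?d \<in> borel_measurable borel"
    unfolding dirichlet_density_def by measurable
  have int: "integrable lborel (?h n)" for n
    using dirichlet_integrable[OF a b f B] by (simp add: set_integrable_def)
  have d_int: "integrable lborel (\<lambda>t. indicator {0<..<1} t *\<^sub>R ?d t)"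
    using dirichlet_integrable[OF a b, of "\<lambda>_. 1" 1] by (simp add: set_integrable_def)
  define K where "K = (LBINT t. norm (indicator {0<..<1} t *\<^sub>R ?d t))"
  have Bnn: "B n \<ge> 0" for n
    using order_trans[OF norm_ge_zero B[of "1/2" n]] by simp
  have le: "norm (?h n t) \<le> B n * norm (indicator {0<..<1} t *\<^sub>R ?d t)" for n t
    using B[of t n] by (auto simp: indicator_def norm_mult intro!: mult_right_mono)
  have "(\<lambda>n. integral\<^sup>L lborel (?h n)) sums (LBINT t. \<Sum>n. ?h n t)"
  proof (rule sums_integral)
    show "AE t in lborel. summable (\<lambda>n. norm (?h n t))"
      by (intro AE_I2 summable_comparison_test'[OF summable_mult2[OF \<open>summable B\<close>]])
         (use le in auto)
    have "(LBINT t. norm (?h n t)) \<le> B n * K" for n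
    proof -
      have "(LBINT t. norm (?h n t)) \<le> (LBINT t. B n * norm (indicator {0<..<1} t *\<^sub>R ?d t))"
        by (intro integral_mono le integrable_norm int integrable_mult_right d_int)
      thus ?thesis by (simp add: K_def)
    qed
    thus "summable (\<lambda>n. LBINT t. norm (?h n t))"
      by (intro summable_comparison_test'[OF summable_mult2[OF \<open>summable B\<close>, of K]])
         (auto simp: integral_nonneg_AE)
  qed (use int in auto)
  also have "(LBINT t. \<Sum>n. ?h n t) = (LBINT t. indicator {0<..<1} t *\<^sub>R (g t * ?d t))"
  proof (rule Bochner_Integration.integral_cong)
    fix t :: real
    show "(\<Sum>n. ?h n t) = indicator {0<..<1} t *\<^sub>R (g t * ?d t)"
      using sums_mult2[OF g, of t "?d t"] by (auto simp: indicator_def sums_iff)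
  qed simp
  finally show ?thesis
    by (simp add: dirichlet_integral_def set_lebesgue_integral_def)
qed

section \<open>Analytic continuation of the Gauss series\<close>

definition gauss_coeff :: "complex \<Rightarrow> complex \<Rightarrow> complex \<Rightarrow> nat \<Rightarrow> complex" where
  "gauss_coeff a b c n = pochhammer a n * pochhammer b n / (pochhammer c n * fact n)"

lemma gauss_series_sums:
  assumes "Re c > 0" "norm z < 1"
  shows "(\<lambda>n. gauss_coeff a b c n * z ^ n) sums gauss_series a b c z"
proof -
  have eq: "pochhammer a n * pochhammer b n / pochhammer c n * (z ^ n / fact n) = gauss_coeff a b c n * z ^ n" for n
    by (simp add: gauss_coeff_def)
  have "summable (\<lambda>n. gauss_coeff a b c n * z ^ n)"
    \<comment> \<open>At t = 0 the row form is the Gauss series itself, which gives its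
      convergence.\<close>
    using binomial_double_row_form[OF subexponential_pochhammer_ratio[OF assms(1), of b], of z 0 a] assms(2)
    by (simp add: sums_iff gauss_coeff_def)
  thus ?thesis
    unfolding gauss_series_def eq by (rule summable_sums)
qed

section \<open>The operator z d/dz and contiguous relations\<close>

lemma powser_times_deriv_sums:
  fixes f :: "complex \<Rightarrow> complex"
  assumes f: "\<And>z. norm z < 1 \<Longrightarrow> (\<lambda>n. c n * z ^ n) sums f z" and z: "norm z < 1"
  shows "(f has_field_derivative deriv f z) (at z)"
    and "(\<lambda>n. of_nat n * c n * z ^ n) sums (z * deriv f z)"
proof -
  have sm: "summable (\<lambda>n. c n * z ^ n)" if "norm z < 1" for z
    using f[OF that] by (simp add: sums_iff)
  have "((\<lambda>z. \<Sum>n. c n * z ^ n) has_field_derivative (\<Sum>n. diffs c n * z ^ n)) (at z)"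
    by (rule termdiffs_strong'[OF sm z])
  hence D: "(f has_field_derivative (\<Sum>n. diffs c n * z ^ n)) (at z)"
    by (rule has_field_derivative_transform_within_open[where S = "ball 0 1"])
       (use z f in \<open>auto simp: sums_iff\<close>)
  thus "(f has_field_derivative deriv f z) (at z)"
    by (simp add: DERIV_imp_deriv)
  have "summable (\<lambda>n. diffs c n * z ^ n)"
    by (rule termdiff_converges[OF z sm])
  hence "(\<lambda>n. diffs c n * z ^ n) sums deriv f z"
    using D by (simp add: DERIV_imp_deriv summable_sums)
  hence "(\<lambda>n. of_nat (Suc n) * c (Suc n) * z ^ Suc n) sums (z * deriv f z)"
    using sums_mult[of _ _ z] by (force simp: diffs_def mult_ac)
  thus "(\<lambda>n. of_nat n * c n * z ^ n) sums (z * deriv f z)"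
    using sums_Suc[of "\<lambda>n. of_nat n * c n * z ^ n" "z * deriv f z"] by simp
qed

text \<open>Coefficientwise this is 1/(c)_n = (1 + n/c)/(c+1)_n, with n realised by z d/dz. As
  \<open>f\<close> is only prescribed on the disc, it may be any continuation of the series, and the
  right-hand side then makes sense wherever \<open>f\<close> is holomorphic.\<close>

lemma gauss_series_contiguous_c:
  assumes c: "Re c > 0" and z: "norm z < 1"
    and f: "\<And>z. norm z < 1 \<Longrightarrow> f z = gauss_series a b (c + 1) z"
  shows "gauss_series a b c z = f z + z / c * deriv f z"
proof -
  let ?T = "gauss_coeff a b (c + 1)"
  have c0: "c \<noteq> 0" using c by auto
  have s: "(\<lambda>n. ?T n * z ^ n) sums f z" if "norm z < 1" for z
    using gauss_series_sums[of "c + 1" z a b] f that c by simp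
  have "(\<lambda>n. ?T n * z ^ n + 1 / c * (of_nat n * ?T n * z ^ n)) sums (f z + 1 / c * (z * deriv f z))"
    by (intro sums_add sums_mult s powser_times_deriv_sums(2)[OF s z] z)
  moreover have "?T n * z ^ n + 1 / c * (of_nat n * ?T n * z ^ n) = gauss_coeff a b c n * z ^ n" for n
  proof -
    have "pochhammer c n * (c + of_nat n) = c * pochhammer (c + 1) n"
      by (metis pochhammer_Suc pochhammer_rec)
    moreover have "pochhammer c n \<noteq> 0" "pochhammer (c + 1) n \<noteq> 0"
      using c by (auto intro!: pochhammer_nonzero_of_Re_pos simp del: pochhammer_eq_0_iff)
    ultimately have "(1 + of_nat n / c) / pochhammer (c + 1) n = 1 / pochhammer c n"
      using c0 by (simp add: field_simps)
    hence "gauss_coeff a b c n = ?T n * (1 + of_nat n / c)"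
      unfolding gauss_coeff_def
      by (metis (no_types, lifting) divide_divide_eq_left mult.commute mult_1 times_divide_eq_left times_divide_eq_right)
    thus ?thesis
      by (simp add: algebra_simps)
  qed
  ultimately show ?thesis
    using gauss_series_sums[OF c z, of a b] by (auto simp: sums_iff)
qed

text \<open>Let T_n be the coefficients for b + 1. Comparing powers of z reduces the relation to
  (c-b-1+n) T_n - (a+n-1) T_(n-1) = (c-b-1) times the n-th coefficient for b.\<close>

lemma gauss_series_contiguous_b:
  assumes c: "Re c > 0" and z: "norm z < 1"
    and f: "\<And>z. norm z < 1 \<Longrightarrow> f z = gauss_series a (b + 1) c z"
  shows "(c - b - 1) * gauss_series a b c z = (c - b - 1 - a * z) * f z + z * (1 - z) * deriv f z"
proof -
  let ?T = "gauss_coeff a (b + 1) c"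
  have s: "(\<lambda>n. ?T n * z ^ n) sums f z" if "norm z < 1" for z
    using gauss_series_sums[of c z a "b + 1"] f that c by simp
  note d = powser_times_deriv_sums(2)[OF s z]
  \<comment> \<open>The terms of z (a f + z f'), moved up by one place; hence the value 0 at n =
    0.\<close>
  define U where "U n = (if n = 0 then 0 else (a + of_nat n - 1) * ?T (n - 1) * z ^ n)" for n
  have "(\<lambda>n. z * (a * (?T n * z ^ n) + of_nat n * ?T n * z ^ n)) sums (z * (a * f z + z * deriv f z))"
    by (intro sums_add sums_mult s d z)
  hence "(\<lambda>n. U (Suc n)) sums (z * (a * f z + z * deriv f z))"
    by (simp add: U_def algebra_simps)
  hence U: "U sums (z * (a * f z + z * deriv f z))"
    using sums_Suc[of U] by (simp add: U_def)
  have "(\<lambda>n. (c - b - 1) * (?T n * z ^ n) + of_nat n * ?T n * z ^ n - U n) sums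
      ((c - b - 1) * f z + z * deriv f z - z * (a * f z + z * deriv f z))"
    by (intro sums_add sums_diff sums_mult s d U z)
  moreover have "(c - b - 1) * (?T n * z ^ n) + of_nat n * ?T n * z ^ n - U n =
      (c - b - 1) * (gauss_coeff a b c n * z ^ n)" for n
  proof (cases n)
    case 0
    thus ?thesis by (simp add: U_def gauss_coeff_def)
  next
    case (Suc m)
    \<comment> \<open>With n = m + 1 = k, \<open>P\<close> is the factor shared by T_n, (a+m) T_m
      and the coefficient for b, so that only a polynomial identity in b, c and k remains.\<close>
    define P where "P = pochhammer a m * (a + of_nat m) * pochhammer (b + 1) m / (pochhammer c m * fact m)"
    define k where "k = (1 + of_nat m :: complex)"
    have nz: "c + of_nat m \<noteq> 0" "k \<noteq> 0"
    proof -
      show "c + of_nat m \<noteq> 0"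
        using pochhammer_nonzero_of_Re_pos[OF c, of "Suc m"] by (simp add: pochhammer_Suc)
      show "k \<noteq> 0"
        unfolding k_def by (metis of_nat_Suc of_nat_eq_0_iff nat.distinct(1))
    qed
    have 1: "?T n = P * (b + k) / ((c + of_nat m) * k)"
      unfolding Suc by (simp add: gauss_coeff_def P_def k_def pochhammer_Suc mult_ac add_ac)
    have 2: "(a + of_nat m) * ?T m = P"
      by (simp add: gauss_coeff_def P_def mult_ac)
    have 3: "gauss_coeff a b c n = P * b / ((c + of_nat m) * k)"
      unfolding Suc gauss_coeff_def pochhammer_rec[of b]
      by (simp add: P_def k_def pochhammer_Suc mult_ac)
    have "(c - b - 1 + k) * (b + k) - (c + of_nat m) * k = (c - b - 1) * b"
      by (simp add: k_def algebra_simps)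
    hence "(c - b - 1 + k) * ?T n - P = (c - b - 1) * gauss_coeff a b c n"
    proof -
      have "(c - b - 1 + k) * ?T n - P = P * ((c - b - 1 + k) * (b + k) - (c + of_nat m) * k) / ((c + of_nat m) * k)"
        unfolding 1 using nz by (simp add: diff_divide_distrib right_diff_distrib mult_ac)
      thus ?thesis
        unfolding \<open>_ = (c - b - 1) * b\<close> 3 by (simp add: mult_ac)
    qed
    moreover have "U n = P * z ^ n" "of_nat n = k"
      using 2 by (simp_all add: U_def Suc k_def mult.assoc)
    moreover have "(c - b - 1) * (?T n * z ^ n) + k * ?T n * z ^ n - P * z ^ n =
        ((c - b - 1 + k) * ?T n - P) * z ^ n"
      by (simp add: algebra_simps)
    ultimately show ?thesis
      by (simp add: mult.assoc)
  qed
  ultimately have "(\<lambda>n. (c - b - 1) * (gauss_coeff a b c n * z ^ n)) sums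
      ((c - b - 1) * f z + z * deriv f z - z * (a * f z + z * deriv f z))"
    by simp
  moreover have "(\<lambda>n. (c - b - 1) * (gauss_coeff a b c n * z ^ n)) sums ((c - b - 1) * gauss_series a b c z)"
    by (intro sums_mult gauss_series_sums c z)
  ultimately have "(c - b - 1) * gauss_series a b c z =
      (c - b - 1) * f z + z * deriv f z - z * (a * f z + z * deriv f z)"
    by (rule sums_unique2[rotated])
  also have "\<dots> = (c - b - 1 - a * z) * f z + z * (1 - z) * deriv f z"
    by (simp add: algebra_simps)
  finally show ?thesis .
qed

section \<open>Holomorphic continuation to the cut plane\<close>

lemma open_cut_plane: "open cut_plane"
proof -
  have "cut_plane = - (\<real> \<inter> {z. Re z \<ge> 1})"
    by (auto simp: cut_plane_def complex_is_Real_iff complex_eq_iff image_iff)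
  moreover have "closed (\<real> \<inter> {z :: complex. Re z \<ge> 1})"
    by (intro closed_Int closed_complex_Reals closed_halfspace_Re_ge)
  ultimately show ?thesis
    using open_Compl by metis
qed

lemma disc_subset_cut_plane: "norm z < 1 \<Longrightarrow> z \<in> cut_plane"
  by (auto simp: cut_plane_def)

text \<open>Exactly the existence statement that gives the choice in \<open>hyp2F1\<close> a
  witness.\<close>

definition gauss_extends :: "complex \<Rightarrow> complex \<Rightarrow> complex \<Rightarrow> bool" where
  "gauss_extends a b c \<longleftrightarrow>
     (\<exists>f. f holomorphic_on cut_plane \<and> (\<forall>z. norm z < 1 \<longrightarrow> f z = gauss_series a b c z))"

lemma gauss_extends_lower_c:
  assumes "gauss_extends a b (c + 1)" and c: "Re c > 0"
  shows "gauss_extends a b c"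
proof -
  from assms(1) obtain f where f: "f holomorphic_on cut_plane"
    "\<And>z. norm z < 1 \<Longrightarrow> f z = gauss_series a b (c + 1) z"
    unfolding gauss_extends_def by blast
  have "(\<lambda>z. f z + z / c * deriv f z) holomorphic_on cut_plane"
    using c by (intro holomorphic_intros f open_cut_plane) auto
  thus ?thesis
    unfolding gauss_extends_def using gauss_series_contiguous_c[OF c _ f(2)]
    by (intro exI[of _ "\<lambda>z. f z + z / c * deriv f z"]) auto
qed

lemma gauss_extends_lower_b:
  assumes "gauss_extends a (b + 1) c" and c: "Re c > 0" "c - b - 1 \<noteq> 0"
  shows "gauss_extends a b c"
proof -
  from assms(1) obtain f where f: "f holomorphic_on cut_plane"
    "\<And>z. norm z < 1 \<Longrightarrow> f z = gauss_series a (b + 1) c z"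
    unfolding gauss_extends_def by blast
  let ?g = "\<lambda>z. ((c - b - 1 - a * z) * f z + z * (1 - z) * deriv f z) / (c - b - 1)"
  have "?g holomorphic_on cut_plane"
    using c by (intro holomorphic_intros f open_cut_plane) auto
  moreover have "?g z = gauss_series a b c z" if "norm z < 1" for z
    using gauss_series_contiguous_b[OF c(1) that f(2)] c(2) by (simp add: field_simps)
  ultimately show ?thesis
    unfolding gauss_extends_def by (intro exI[of _ ?g]) auto
qed

text \<open>If 1 - t z = x with x real and x \<le> 0, then t > 0 and z = (1-x)/t \<ge> 1 lies on the
  cut. Thus the principal power in Euler's integral stays off its branch cut.\<close>

lemma one_minus_times_not_nonpos:
  assumes "z \<in> cut_plane" "t \<in> {0..1}"
  shows "1 - complex_of_real t * z \<notin> \<real>\<^sub>\<le>\<^sub>0"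
proof
  assume "1 - complex_of_real t * z \<in> \<real>\<^sub>\<le>\<^sub>0"
  then obtain x where x: "1 - complex_of_real t * z = of_real x" "x \<le> 0"
    by (auto elim!: nonpos_Reals_cases)
  have "t \<noteq> 0"
    using x by auto
  hence t: "t > 0" "t \<le> 1"
    using assms(2) by auto
  have "complex_of_real t * z = of_real (1 - x)"
    using x(1) by (simp add: algebra_simps)
  hence "z = of_real ((1 - x) / t)"
    using t by (simp add: field_simps)
  moreover have "(1 - x) / t \<ge> 1"
    using t x(2) by (simp add: field_simps)
  ultimately have "z \<in> complex_of_real ` {1..}"
    by (intro image_eqI) auto
  thus False
    using assms(1) by (simp add: cut_plane_def)
qed

text \<open>Euler's integral is the witness. The strict bounds by 1 make the density continuous up
  to both endpoints, so one can differentiate under the integral over the compact interval. On the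
  disc, the binomial expansion and the moments (b)_n/(c)_n recover the series.\<close>

lemma gauss_extends_Euler:
  assumes b: "Re b > 1" and cb: "Re (c - b) > 1"
  shows "gauss_extends a b c"
proof -
  let ?d = "dirichlet_density b (c - b)"
  let ?f = "\<lambda>z. dirichlet_integral b (c - b) (\<lambda>t. (1 - of_real t * z) powr (- a))"
  have d: "continuous_on {0..1} ?d"
    unfolding dirichlet_density_def using b cb by (intro continuous_intros) auto
  have d': "continuous_on (A \<times> {0..1}) (\<lambda>x. ?d (snd x))" for A :: "complex set"
    by (rule continuous_on_compose2[OF d]) (auto intro!: continuous_intros)
  have pw: "continuous_on (cut_plane \<times> {0..1}) (\<lambda>x. (1 - of_real (snd x) * fst x) powr e)" for e
  proof (intro continuous_on_powr_complex continuous_intros)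
    have *: "1 - of_real (snd x) * fst x \<notin> \<real>\<^sub>\<le>\<^sub>0" if "x \<in> cut_plane \<times> {0..1}" for x :: "complex \<times> real"
      using that by (intro one_minus_times_not_nonpos) auto
    show "cut_plane \<times> {0..1} \<subseteq> {x. 0 \<le> Re (1 - of_real (snd x) * fst x) \<or> Im (1 - of_real (snd x) * fst x) \<noteq> 0}"
      using * by (force simp: complex_nonpos_Reals_iff)
    show "0 < Re e" if "x \<in> cut_plane \<times> {0..1}" "1 - of_real (snd x) * fst x = 0" for x :: "complex \<times> real"
      using *[OF that(1)] that(2) by simp
  qed
  have cont: "continuous_on {0..1} (\<lambda>t. (1 - of_real t * z) powr e * ?d t)" if "z \<in> cut_plane" for z e
  proof (intro continuous_on_mult d)
    show "continuous_on {0..1} (\<lambda>t. (1 - of_real t * z) powr e)"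
      using that
      by (intro continuous_on_compose2[OF pw, where f = "\<lambda>t. (z, t)", simplified])
         (auto intro!: continuous_intros)
  qed
  have f_eq: "?f z = integral (cbox 0 1) (\<lambda>t. (1 - of_real t * z) powr (- a) * ?d t)"
    if "z \<in> cut_plane" for z
  proof -
    let ?h = "\<lambda>t. (1 - of_real t * z) powr (- a) * ?d t"
    have "set_integrable lborel {0..1} ?h"
      by (rule borel_integrable_atLeastAtMost'[OF cont[OF that]])
    hence "set_integrable lborel {0<..<1} ?h"
      by (rule set_integrable_subset) auto
    from set_borel_integral_eq_integral(2)[OF this] show ?thesis
      by (simp add: dirichlet_integral_def integral_open_interval_real)
  qed
  \<comment> \<open>The cut plane is not convex, so the Leibniz rule is applied on balls inside it.
    There \<open>?fx\<close> is the derivative of the integrand in z.\<close>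
  have "?f analytic_on cut_plane"
    unfolding analytic_on_def
  proof
    fix z0 assume "z0 \<in> cut_plane"
    then obtain e where e: "e > 0" "ball z0 e \<subseteq> cut_plane"
      using open_cut_plane open_contains_ball by blast
    let ?fx = "\<lambda>z t. a * of_real t * (1 - of_real t * z) powr (- a - 1) * ?d t"
    have "(\<lambda>z. integral (cbox 0 1) (\<lambda>t. (1 - of_real t * z) powr (- a) * ?d t)) holomorphic_on ball z0 e"
    proof (rule leibniz_rule_holomorphic[where fx = ?fx])
      fix z and t :: real assume z: "z \<in> ball z0 e" and t: "t \<in> cbox 0 1"
      have "1 - of_real t * z \<notin> \<real>\<^sub>\<le>\<^sub>0"
        using e z t by (intro one_minus_times_not_nonpos) auto
      thus "((\<lambda>z. (1 - of_real t * z) powr (- a) * ?d t) has_field_derivative ?fx z t) (at z within ball z0 e)"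
        by (auto intro!: derivative_eq_intros simp: algebra_simps)
    next
      fix z assume "z \<in> ball z0 e"
      thus "(\<lambda>t. (1 - of_real t * z) powr (- a) * ?d t) integrable_on cbox 0 1"
        using e by (intro integrable_continuous) (auto intro!: cont[simplified])
    next
      show "continuous_on (ball z0 e \<times> cbox 0 1) (\<lambda>(z, t). ?fx z t)"
        unfolding case_prod_unfold using e
        by (intro continuous_on_mult continuous_on_subset[OF pw] d'[simplified] continuous_intros)
           (auto intro!: d'[simplified])
    qed auto
    moreover have "?f holomorphic_on ball z0 e \<longleftrightarrow>
        (\<lambda>z. integral (cbox 0 1) (\<lambda>t. (1 - of_real t * z) powr (- a) * ?d t)) holomorphic_on ball z0 e"
      using e f_eq by (intro holomorphic_cong) auto
    ultimately show "\<exists>e>0. ?f holomorphic_on ball z0 e"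
      using e by blast
  qed
  hence "?f holomorphic_on cut_plane"
    by (rule analytic_imp_holomorphic)
  moreover have "?f z = gauss_series a b c z" if z: "norm z < 1" for z
  proof -
    have "(\<lambda>n. dirichlet_integral b (c - b) (\<lambda>t. pochhammer a n / fact n * (of_real t * z) ^ n)) sums ?f z"
    proof (rule dirichlet_integral_sums)
      show "summable (\<lambda>n. norm (pochhammer a n / fact n * z ^ n))"
        by (rule pochhammer_series_abs_summable[OF z])
      fix t :: real assume t: "t \<in> {0<..<1}"
      have "norm (of_real t * z) \<le> norm z"
        using t by (simp add: norm_mult mult_left_le_one_le)
      thus "norm (pochhammer a n / fact n * (of_real t * z) ^ n) \<le> norm (pochhammer a n / fact n * z ^ n)" for n
        unfolding norm_mult[of "pochhammer a n / fact n"] norm_power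
        by (intro mult_left_mono power_mono) auto
      show "(\<lambda>n. pochhammer a n / fact n * (of_real t * z) ^ n) sums (1 - of_real t * z) powr (- a)"
        using \<open>norm (of_real t * z) \<le> norm z\<close> z by (intro pochhammer_sums_powr) auto
    qed (use b cb in auto)
    moreover have "dirichlet_integral b (c - b) (\<lambda>t. pochhammer a n / fact n * (of_real t * z) ^ n) =
        gauss_coeff a b c n * z ^ n" for n
    proof -
      have "dirichlet_integral b (c - b) (\<lambda>t. pochhammer a n / fact n * (of_real t * z) ^ n) =
        dirichlet_integral b (c - b) (\<lambda>t. (pochhammer a n / fact n * z ^ n) * (of_real t ^ n * of_real (1 - t) ^ 0))"
        by (simp add: power_mult_distrib mult_ac)
      also have "\<dots> = (pochhammer a n / fact n * z ^ n) * (pochhammer b n / pochhammer c n)"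
        unfolding dirichlet_integral_cmult
        by (subst dirichlet_integral_moment) (use b cb in auto)
      finally show ?thesis
        by (simp add: gauss_coeff_def mult_ac)
    qed
    ultimately have "(\<lambda>n. gauss_coeff a b c n * z ^ n) sums ?f z"
      by simp
    moreover have "Re c > 0"
      using b cb by simp
    ultimately show ?thesis
      using gauss_series_sums[OF _ z, of c a b] sums_unique2 by blast
  qed
  ultimately show ?thesis
    unfolding gauss_extends_def by (intro exI[of _ ?f]) auto
qed

text \<open>\<open>N\<close> lifts Re b above 1, and \<open>M\<close> then lifts Re c above Re b + N
  + 1, where Euler's integral applies. The descent lowers b first, while c is still large: each
  divisor c - b - 1 that occurs then has positive real part. Lowering c afterwards only needs Re c >
  0.\<close>

lemma gauss_extends_if_Re_pos:
  assumes c: "Re c > 0"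
  shows "gauss_extends a b c"
proof -
  obtain N :: nat where N: "1 - Re b < of_nat N"
    using reals_Archimedean2 by blast
  obtain M :: nat where M: "Re b + of_nat N + 1 - Re c < of_nat M"
    using reals_Archimedean2 by blast
  have shift_b: "gauss_extends a b c" if "gauss_extends a (b + of_nat n) c" "Re c > 0" "Re c > Re b + of_nat n" for n b c
    using that
  proof (induction n)
    case (Suc n)
    have "c - (b + of_nat n) - 1 \<noteq> 0"
    proof
      assume "c - (b + of_nat n) - 1 = 0"
      hence "Re (c - (b + of_nat n) - 1) = Re 0" by (rule arg_cong)
      thus False using Suc.prems by simp
    qed
    hence "gauss_extends a (b + of_nat n) c"
      using Suc.prems by (intro gauss_extends_lower_b[of a "b + of_nat n"]) (auto simp: add_ac)
    thus ?case
      using Suc by simp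
  qed simp
  have shift_c: "gauss_extends a b c" if "gauss_extends a b (c + of_nat n)" "Re c > 0" for n b c
    using that
  proof (induction n)
    case (Suc n)
    have "gauss_extends a b (c + of_nat n)"
      using Suc.prems by (intro gauss_extends_lower_c[of a b "c + of_nat n"]) (auto simp: add_ac)
    thus ?case
      using Suc by simp
  qed simp
  have "gauss_extends a (b + of_nat N) (c + of_nat M)"
    using N M by (intro gauss_extends_Euler) auto
  hence "gauss_extends a b (c + of_nat M)"
    using M c by (intro shift_b[of b N]) auto
  thus ?thesis
    using c by (rule shift_c)
qed

lemma hyp2F1_holomorphic_and_eq:
  assumes "Re c > 0"
  shows "hyp2F1 a b c holomorphic_on cut_plane"
    and "norm z < 1 \<Longrightarrow> hyp2F1 a b c z = gauss_series a b c z"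
proof -
  have "\<exists>f. f holomorphic_on cut_plane \<and> (\<forall>z. norm z < 1 \<longrightarrow> f z = gauss_series a b c z)"
    using gauss_extends_if_Re_pos[OF assms] by (simp add: gauss_extends_def)
  from someI_ex[OF this, folded hyp2F1_def]
  show "hyp2F1 a b c holomorphic_on cut_plane"
    and "norm z < 1 \<Longrightarrow> hyp2F1 a b c z = gauss_series a b c z"
    by auto
qed

section \<open>Pfaff's transformation and Erdelyi's integral\<close>

text \<open>Reflection turns (c+n)_(m-n) into (1-c-m)_(m-n) up to sign. The sum becomes the binomial
  theorem for Pochhammer symbols at (c-b) + (1-c-m) = 1-b-m, which is reflected back to
  (b)_m.\<close>

lemma Chu_Vandermonde:
  fixes b c :: complex
  assumes "Re c > 0"
  shows "(\<Sum>n\<le>m. of_nat (m choose n) * (pochhammer (c - b) n / pochhammer c n) * (- 1) ^ n) =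
           pochhammer b m / pochhammer c m"
proof -
  have nz: "pochhammer c n \<noteq> 0" for n
    by (rule pochhammer_nonzero_of_Re_pos[OF assms])
  have refl: "pochhammer (1 - x - of_nat m) k = (- 1) ^ k * pochhammer (x + of_nat (m - k)) k" if "k \<le> m" for x :: complex and k
    using pochhammer_minus[of "x + of_nat m - 1" k] that by (simp add: of_nat_diff algebra_simps)
  have "of_nat (m choose n) * (pochhammer (c - b) n / pochhammer c n) * (- 1) ^ n * pochhammer c m =
      (- 1) ^ m * (of_nat (m choose n) * pochhammer (c - b) n * pochhammer (1 - c - of_nat m) (m - n))"
    if "n \<le> m" for n
  proof -
    have 1: "pochhammer c m = pochhammer c n * pochhammer (c + of_nat n) (m - n)"
      using that by (rule pochhammer_product)
    have 2: "pochhammer (1 - c - of_nat m) (m - n) = (- 1) ^ (m - n) * pochhammer (c + of_nat n) (m - n)"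
      using refl[of "m - n" c] that by simp
    have 3: "(- 1) ^ m * (- 1) ^ (m - n) = ((- 1) ^ n :: complex)"
    proof -
      have "m + (m - n) = n + 2 * (m - n)"
        using that by simp
      hence "(- 1) ^ (m + (m - n)) = ((- 1) ^ (n + 2 * (m - n)) :: complex)"
        by (rule arg_cong)
      thus ?thesis
        by (simp add: power_add power_mult)
    qed
    show ?thesis
      unfolding 1 2 3[symmetric] using nz[of n] by simp
  qed
  hence "(\<Sum>n\<le>m. of_nat (m choose n) * (pochhammer (c - b) n / pochhammer c n) * (- 1) ^ n) * pochhammer c m =
      (- 1) ^ m * (\<Sum>n\<le>m. of_nat (m choose n) * pochhammer (c - b) n * pochhammer (1 - c - of_nat m) (m - n))"
    unfolding sum_distrib_right sum_distrib_left by (intro sum.cong) auto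
  also have "\<dots> = (- 1) ^ m * pochhammer (1 - b - of_nat m) m"
    by (simp add: diff_diff_eq2 add.commute diff_diff_eq flip: pochhammer_binomial_sum)
  also have "\<dots> = pochhammer b m"
    using refl[of m b] by (simp flip: power_mult_distrib mult.assoc)
  finally show ?thesis
    using nz[of m] by (simp add: field_simps)
qed

text \<open>Take s = -u, t = u and q_n = (c-b)_n/(c)_n in the double series. The rows give the
  left-hand side, as s/(1-t) = u/(u-1), and the diagonals collapse to the right-hand side by
  Chu-Vandermonde. The bound 1/2 ensures \<open>norm s + norm t < 1\<close>.\<close>

lemma Pfaff_transformation_small:
  assumes c: "Re c > 0" and u: "norm u < 1 / 2"
  shows "(1 - u) powr (- a) * gauss_series a (c - b) c (u / (u - 1)) = gauss_series a b c u"
proof -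
  define q where "q n = pochhammer (c - b) n / pochhammer c n" for n
  have q: "subexponential q"
    unfolding q_def by (rule subexponential_pochhammer_ratio[OF c])
  define I where "I = infsum (binomial_double_term a q (- u) u) UNIV"
  have st: "norm (- u) + norm u < 1"
    using u by simp
  have u1: "norm u < norm (u - 1)"
    using u norm_triangle_ineq2[of 1 u] by (simp add: norm_minus_commute)
  hence w: "norm (u / (u - 1)) < 1"
    by (simp add: norm_divide divide_less_eq)
  have "- u / (1 - u) = u / (u - 1)"
    using minus_divide_divide[of u "u - 1"] by (simp only: minus_diff_eq)
  hence "(\<lambda>n. (1 - u) powr (- a) * (gauss_coeff a (c - b) c n * (u / (u - 1)) ^ n)) sums I"
    using binomial_double_row_form[OF q st, of a]
    by (simp add: I_def q_def gauss_coeff_def)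
  moreover have "(\<lambda>n. (1 - u) powr (- a) * (gauss_coeff a (c - b) c n * (u / (u - 1)) ^ n)) sums
      ((1 - u) powr (- a) * gauss_series a (c - b) c (u / (u - 1)))"
    by (intro sums_mult gauss_series_sums c w)
  ultimately have 1: "(1 - u) powr (- a) * gauss_series a (c - b) c (u / (u - 1)) = I"
    by (rule sums_unique2[rotated])
  have "pochhammer a m / fact m * (\<Sum>n\<le>m. of_nat (m choose n) * q n * (- u) ^ n * u ^ (m - n)) =
      gauss_coeff a b c m * u ^ m" for m
  proof -
    have "(\<Sum>n\<le>m. of_nat (m choose n) * q n * (- u) ^ n * u ^ (m - n)) =
        (\<Sum>n\<le>m. of_nat (m choose n) * q n * (- 1) ^ n) * u ^ m"
      unfolding sum_distrib_right
    proof (intro sum.cong refl)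
      fix n assume "n \<in> {..m}"
      hence "u ^ m = u ^ n * u ^ (m - n)"
        by (simp flip: power_add)
      thus "of_nat (m choose n) * q n * (- u) ^ n * u ^ (m - n) = of_nat (m choose n) * q n * (- 1) ^ n * u ^ m"
        by (simp add: power_minus[of u])
    qed
    thus ?thesis
      using Chu_Vandermonde[OF c, of m b] by (simp add: q_def gauss_coeff_def mult.commute mult.assoc)
  qed
  hence "(\<lambda>m. gauss_coeff a b c m * u ^ m) sums I"
    using binomial_double_diagonal_form[OF q st, of a] by (simp add: I_def)
  hence "gauss_series a b c u = I"
    using gauss_series_sums[OF c, of u a b] u sums_unique2 by fastforce
  with 1 show ?thesis by simp
qed

text \<open>Both sides are holomorphic on the unit disc and agree on the disc of radius 1/2. For
  larger u the argument u/(u-1) can leave the unit disc, which is why \<open>hyp2F1\<close> appears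
  on the left.\<close>

lemma Pfaff_transformation:
  assumes c: "Re c > 0" and u: "norm u < 1"
  shows "(1 - u) powr (- a) * hyp2F1 a (c - b) c (u / (u - 1)) = gauss_series a b c u"
proof -
  note H = hyp2F1_holomorphic_and_eq[OF c]
  have "(1 - u) powr (- a) * hyp2F1 a (c - b) c (u / (u - 1)) = hyp2F1 a b c u"
  proof (rule analytic_continuation_open[of "ball 0 (1/2)" "ball 0 1"
        "\<lambda>u. (1 - u) powr (- a) * hyp2F1 a (c - b) c (u / (u - 1))"])
    \<comment> \<open>If u/(u-1) = x \<ge> 1 then (x-1) u = x, which is impossible for
      \<open>norm u < 1\<close> since the left side has norm at most x - 1.\<close>
    have cp: "u / (u - 1) \<in> cut_plane" if "norm u < 1" for u :: complex
    proof (rule ccontr)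
      assume "u / (u - 1) \<notin> cut_plane"
      then obtain x :: real where x: "u / (u - 1) = of_real x" "x \<ge> 1"
        by (auto simp: cut_plane_def)
      have "u \<noteq> 1"
        using that by auto
      hence "u = of_real x * (u - 1)"
        using x(1) by (simp add: field_simps)
      hence eq: "of_real (x - 1) * u = of_real x"
        by (simp add: algebra_simps)
      have "x = norm (of_real (x - 1) * u)"
        using eq x(2) by simp
      also have "\<dots> = (x - 1) * norm u"
        using x(2) by (simp add: norm_mult del: of_real_diff)
      also have "\<dots> \<le> (x - 1) * 1"
        using x(2) that by (intro mult_left_mono) auto
      finally show False by simp
    qed
    have "(\<lambda>u. hyp2F1 a (c - b) c (u / (u - 1))) holomorphic_on ball 0 1"
    proof (rule holomorphic_on_compose_gen[OF _ H(1), unfolded o_def])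
      show "(\<lambda>u. u / (u - 1)) holomorphic_on ball 0 (1 :: real)"
        by (intro holomorphic_intros) auto
    qed (use cp in auto)
    moreover have "(\<lambda>u. (1 - u) powr (- a)) holomorphic_on ball 0 1"
    proof (intro holomorphic_intros)
      fix u :: complex assume "u \<in> ball 0 1"
      hence "Re u < 1"
        using complex_Re_le_cmod[of u] by simp
      thus "1 - u \<notin> \<real>\<^sub>\<le>\<^sub>0"
        by (simp add: complex_nonpos_Reals_iff)
    qed
    ultimately show "(\<lambda>u. (1 - u) powr (- a) * hyp2F1 a (c - b) c (u / (u - 1))) holomorphic_on ball 0 1"
      by (intro holomorphic_on_mult)
    show "hyp2F1 a b c holomorphic_on ball 0 1"
      by (rule holomorphic_on_subset[OF H(1)]) (auto intro: disc_subset_cut_plane)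
    fix u :: complex assume "u \<in> ball 0 (1 / 2)"
    hence u: "norm u < 1 / 2" by simp
    have "norm u < norm (u - 1)"
      using u norm_triangle_ineq2[of 1 u] by (simp add: norm_minus_commute)
    hence "norm (u / (u - 1)) < 1"
      by (simp add: norm_divide divide_less_eq)
    thus "(1 - u) powr (- a) * hyp2F1 a (c - b) c (u / (u - 1)) = hyp2F1 a b c u"
      using Pfaff_transformation_small[OF c u] u by (simp add: H(2))
  qed (use u in auto)
  thus ?thesis
    using u by (simp add: H(2))
qed

section \<open>Erdelyi's integral\<close>

lemma gauss_series_abs_summable:
  assumes c: "Re c > 0" and z: "norm z < 1"
  shows "summable (\<lambda>n. norm (gauss_coeff a b c n * z ^ n))"
proof -
  obtain r where r: "norm z < r" "r < 1"
    using dense[OF z] by blast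
  hence "r \<ge> 0"
    using norm_ge_zero[of z] by linarith
  have "summable (\<lambda>n. gauss_coeff a b c n * of_real r ^ n)"
    using gauss_series_sums[OF c, of "of_real r" a b] r \<open>r \<ge> 0\<close> by (simp add: sums_iff)
  thus ?thesis
    by (rule powser_insidea) (use r \<open>r \<ge> 0\<close> in simp)
qed

text \<open>Two Vandermonde sums. Over n, after (l)_j cancels, the parameters add up to (b-l) +
  (l+j) = b + j. Over j, they add up to (a-a') + a' = a.\<close>

lemma Erdelyi_coefficient:
  fixes a a' b l nu :: complex
  assumes l: "Re l > 0" and nu: "Re nu > 0"
  shows "(\<Sum>j\<le>N. \<Sum>n\<le>N - j. gauss_coeff (a - a') b l j * (pochhammer a' (N - j) / fact (N - j)) *
            (of_nat (N - j choose n) * (pochhammer (b - l) n / pochhammer nu n)) *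
            (pochhammer l (j + (N - j - n)) * pochhammer nu n / pochhammer (l + nu) (j + (N - j - n) + n))) =
         gauss_coeff a b (l + nu) N" (is "?lhs = _")
proof -
  have inner: "(\<Sum>n\<le>N - j. gauss_coeff (a - a') b l j * (pochhammer a' (N - j) / fact (N - j)) *
            (of_nat (N - j choose n) * (pochhammer (b - l) n / pochhammer nu n)) *
            (pochhammer l (j + (N - j - n)) * pochhammer nu n / pochhammer (l + nu) (j + (N - j - n) + n))) =
     pochhammer b N / (pochhammer (l + nu) N * fact N) *
       (of_nat (N choose j) * pochhammer (a - a') j * pochhammer a' (N - j))" (is "?L = ?R")
    if j: "j \<le> N" for j
  proof -
    define M where "M = N - j"
    have N: "N = j + M"
      using j by (simp add: M_def)
    let ?K = "pochhammer (a - a') j * pochhammer b j / fact j * (pochhammer a' M / fact M) / pochhammer (l + nu) N"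
    have nz: "pochhammer l j \<noteq> 0" "pochhammer nu n \<noteq> 0" for n
      using pochhammer_nonzero_of_Re_pos l nu by auto
    have "?L = (\<Sum>n\<le>M. ?K * (of_nat (M choose n) * pochhammer (b - l) n * pochhammer (l + of_nat j) (M - n)))"
      unfolding M_def[symmetric]
    proof (intro sum.cong refl)
      fix n assume "n \<in> {..M}"
      hence "j + (M - n) + n = N"
        using N by simp
      thus "gauss_coeff (a - a') b l j * (pochhammer a' M / fact M) *
            (of_nat (M choose n) * (pochhammer (b - l) n / pochhammer nu n)) *
            (pochhammer l (j + (M - n)) * pochhammer nu n / pochhammer (l + nu) (j + (M - n) + n)) =
          ?K * (of_nat (M choose n) * pochhammer (b - l) n * pochhammer (l + of_nat j) (M - n))"
        using nz unfolding gauss_coeff_def pochhammer_product'[of l j] by simp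
    qed
    also have "\<dots> = ?K * pochhammer (b - l + (l + of_nat j)) M"
      unfolding pochhammer_binomial_sum[of "b - l" "l + of_nat j"] sum_distrib_left ..
    also have "\<dots> = ?K * pochhammer (b + of_nat j) M"
      by simp
    also have "\<dots> = pochhammer (a - a') j * pochhammer a' M / (fact j * fact M) * pochhammer b N / pochhammer (l + nu) N"
      unfolding N pochhammer_product'[of b j] by simp
    also have "\<dots> = ?R"
      using j by (simp add: M_def binomial_fact mult_ac)
    finally show ?thesis .
  qed
  have "(\<Sum>j\<le>N. of_nat (N choose j) * pochhammer (a - a') j * pochhammer a' (N - j)) = pochhammer a N"
    using pochhammer_binomial_sum[of "a - a'" a' N] by simp
  hence "(\<Sum>j\<le>N. pochhammer b N / (pochhammer (l + nu) N * fact N) *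
       (of_nat (N choose j) * pochhammer (a - a') j * pochhammer a' (N - j))) = gauss_coeff a b (l + nu) N"
    unfolding sum_distrib_left[symmetric] gauss_coeff_def by simp
  moreover have "?lhs = (\<Sum>j\<le>N. pochhammer b N / (pochhammer (l + nu) N * fact N) *
       (of_nat (N choose j) * pochhammer (a - a') j * pochhammer a' (N - j)))"
    by (intro sum.cong refl inner) simp
  ultimately show ?thesis
    by (simp only:)
qed

text \<open>The integrand is expanded in powers of x as a Cauchy product. Each coefficient is a
  polynomial in v and 1 - v, whose moments sum to the Gauss coefficient by
  \<open>Erdelyi_coefficient\<close>.\<close>

theorem Erdelyi_integral:
  fixes a a' b l nu x :: complex
  assumes l: "Re l > 0" and nu: "Re nu > 0" and x: "norm x < 1"
  shows "dirichlet_integral l nu (\<lambda>v. gauss_series (a - a') b l (of_real v * x) *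
           ((1 - of_real v * x) powr (- a') *
             gauss_series a' (b - l) nu (of_real (1 - v) * x / (1 - of_real v * x)))) =
         gauss_series a b (l + nu) x"
proof -
  define q where "q n = pochhammer (b - l) n / pochhammer nu n" for n
  have q: "subexponential q"
    unfolding q_def by (rule subexponential_pochhammer_ratio[OF nu])
  define f where "f j v = gauss_coeff (a - a') b l j * (of_real v * x) ^ j" for j and v :: real
  \<comment> \<open>The diagonal form of the second factor, with s = (1-v) x and t = v x. It is
    homogeneous of degree m in x, and for 0 < v < 1 the norms of s and t add up to exactly
    \<open>norm x\<close>.\<close>
  define g where "g m v = pochhammer a' m / fact m *
      (\<Sum>n\<le>m. of_nat (m choose n) * q n * (of_real (1 - v) * x) ^ n * (of_real v * x) ^ (m - n))" for m and v :: real
  define h where "h v = gauss_series (a - a') b l (of_real v * x) * ((1 - of_real v * x) powr (- a') *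
             gauss_series a' (b - l) nu (of_real (1 - v) * x / (1 - of_real v * x)))" for v :: real
  obtain r where r: "r > 1" "r * norm x < 1"
    using ex_scaling_gt_1[of "norm x" 0] x by auto
  obtain C where C: "C \<ge> 0" "\<And>n. norm (q n) \<le> C * r ^ n"
    using subexponentialE[OF q r(1)] by blast
  define F where "F j = norm (gauss_coeff (a - a') b l j * x ^ j)" for j
  \<comment> \<open>A majorant of \<open>g\<close> independent of v: the growth of \<open>q\<close>
    is absorbed by r, and the remaining binomial sum is ((1-v) + v)^m = 1.\<close>
  define G where "G m = C * norm (pochhammer a' m / fact m * (of_real (r * norm x)) ^ m)" for m
  have F: "summable F"
    unfolding F_def by (rule gauss_series_abs_summable[OF l x])
  have G: "summable G"
    unfolding G_def using r by (intro summable_mult pochhammer_series_abs_summable) (simp add: norm_mult)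
  have FG: "summable (\<lambda>k. \<Sum>i\<le>k. F i * G (k - i))"
  proof (rule summable_Cauchy_product)
    have "norm (F k) = F k" "norm (G k) = G k" for k
      using C(1) by (auto simp: F_def G_def abs_mult)
    thus "summable (\<lambda>k. norm (F k))" "summable (\<lambda>k. norm (G k))"
      using F G by simp_all
  qed
  have fF: "norm (f j v) \<le> F j" if "v \<in> {0<..<1}" for j v
  proof -
    have "norm (of_real v * x) \<le> norm x"
      using that by (simp add: norm_mult mult_left_le_one_le)
    thus ?thesis
      unfolding f_def F_def norm_mult[of "gauss_coeff (a - a') b l j"] norm_power
      by (intro mult_left_mono power_mono) auto
  qed
  have gG: "norm (g m v) \<le> G m" if v: "v \<in> {0<..<1}" for m v
  proof -
    have "norm (\<Sum>n\<le>m. of_nat (m choose n) * q n * (of_real (1 - v) * x) ^ n * (of_real v * x) ^ (m - n)) \<le>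
        (\<Sum>n\<le>m. C * (r * norm x) ^ m * (of_nat (m choose n) * (1 - v) ^ n * v ^ (m - n)))"
    proof (rule order_trans[OF norm_sum sum_mono])
      fix n assume "n \<in> {..m}"
      hence n: "n \<le> m" by simp
      have "norm (of_nat (m choose n) * q n * (of_real (1 - v) * x) ^ n * (of_real v * x) ^ (m - n)) =
          norm (q n) * (norm x ^ n * norm x ^ (m - n)) * (of_nat (m choose n) * (1 - v) ^ n * v ^ (m - n))"
        using v by (simp add: norm_mult norm_power power_mult_distrib mult_ac del: of_real_diff)
      also have "norm x ^ n * norm x ^ (m - n) = norm x ^ m"
        using n by (simp flip: power_add)
      also have "norm (q n) * norm x ^ m * (of_nat (m choose n) * (1 - v) ^ n * v ^ (m - n)) \<le>
          C * r ^ m * norm x ^ m * (of_nat (m choose n) * (1 - v) ^ n * v ^ (m - n))"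
      proof (intro mult_right_mono)
        have "norm (q n) \<le> C * r ^ n" by (rule C)
        also have "\<dots> \<le> C * r ^ m"
          using n r C by (intro mult_left_mono power_increasing) auto
        finally show "norm (q n) \<le> C * r ^ m" .
      qed (use v in auto)
      finally show "norm (of_nat (m choose n) * q n * (of_real (1 - v) * x) ^ n * (of_real v * x) ^ (m - n)) \<le>
          C * (r * norm x) ^ m * (of_nat (m choose n) * (1 - v) ^ n * v ^ (m - n))"
        by (simp add: power_mult_distrib mult_ac)
    qed
    also have "\<dots> = C * (r * norm x) ^ m * ((1 - v) + v) ^ m"
      unfolding sum_distrib_left[symmetric] binomial_ring by simp
    finally have "norm (pochhammer a' m / fact m) * norm (\<Sum>n\<le>m. of_nat (m choose n) * q n * (of_real (1 - v) * x) ^ n * (of_real v * x) ^ (m - n)) \<le>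
      norm (pochhammer a' m / fact m) * (C * (r * norm x) ^ m)"
      by (intro mult_left_mono) auto
    thus ?thesis
      unfolding g_def G_def norm_mult[of "pochhammer a' m / fact m"]
      using r by (simp add: norm_power norm_mult mult_ac)
  qed
  have fs: "(\<lambda>j. f j v) sums gauss_series (a - a') b l (of_real v * x)" if v: "v \<in> {0<..<1}" for v
  proof -
    have "norm (of_real v * x) \<le> norm x"
      using v by (simp add: norm_mult mult_left_le_one_le)
    thus ?thesis
      unfolding f_def using x by (intro gauss_series_sums l) auto
  qed
  have gs: "(\<lambda>m. g m v) sums ((1 - of_real v * x) powr (- a') *
      gauss_series a' (b - l) nu (of_real (1 - v) * x / (1 - of_real v * x)))" if v: "v \<in> {0<..<1}" for v
  proof -
    let ?s = "of_real (1 - v) * x" and ?t = "of_real v * x"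
    have n1: "norm ?s + norm ?t = norm x"
      using v by (simp add: norm_mult algebra_simps del: of_real_diff)
    hence st: "norm ?s + norm ?t < 1"
      using x by simp
    have "norm ?s < 1 - norm ?t"
      using st by simp
    also have "\<dots> \<le> norm (1 - ?t)"
      using norm_triangle_ineq2[of 1 ?t] by simp
    finally have lt: "norm (?s / (1 - ?t)) < 1"
      by (simp add: norm_divide divide_less_eq del: of_real_diff)
    have "(\<lambda>n. (1 - ?t) powr (- a') * (gauss_coeff a' (b - l) nu n * (?s / (1 - ?t)) ^ n)) sums
        ((1 - ?t) powr (- a') * gauss_series a' (b - l) nu (?s / (1 - ?t)))"
      by (intro sums_mult gauss_series_sums nu lt)
    hence "(\<lambda>n. (1 - ?t) powr (- a') * (pochhammer a' n * q n / fact n * (?s / (1 - ?t)) ^ n)) sums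
        ((1 - ?t) powr (- a') * gauss_series a' (b - l) nu (?s / (1 - ?t)))"
      by (simp add: gauss_coeff_def q_def)
    from sums_unique2[OF this binomial_double_row_form[OF q st]] binomial_double_diagonal_form[OF q st, of a']
    show ?thesis
      by (simp add: g_def)
  qed
  have "(\<lambda>N. dirichlet_integral l nu (\<lambda>v. \<Sum>j\<le>N. f j v * g (N - j) v)) sums dirichlet_integral l nu h"
  proof (rule dirichlet_integral_sums[OF l nu _ _ FG])
    show "(\<lambda>v. \<Sum>j\<le>N. f j v * g (N - j) v) \<in> borel_measurable borel" for N
      unfolding f_def g_def by measurable
    fix v :: real assume v: "v \<in> {0<..<1}"
    show "norm (\<Sum>j\<le>N. f j v * g (N - j) v) \<le> (\<Sum>j\<le>N. F j * G (N - j))" for N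
    proof (rule order_trans[OF norm_sum sum_mono])
      fix j
      have "F j \<ge> 0"
        by (simp add: F_def)
      thus "norm (f j v * g (N - j) v) \<le> F j * G (N - j)"
        unfolding norm_mult by (intro mult_mono fF[OF v] gG[OF v]) auto
    qed
    have "(\<lambda>N. \<Sum>j\<le>N. f j v * g (N - j) v) sums ((\<Sum>j. f j v) * (\<Sum>m. g m v))"
    proof (rule Cauchy_product_sums)
      show "summable (\<lambda>j. norm (f j v))"
        by (rule summable_comparison_test'[OF F]) (use fF[OF v] in auto)
      show "summable (\<lambda>m. norm (g m v))"
        by (rule summable_comparison_test'[OF G]) (use gG[OF v] in auto)
    qed
    thus "(\<lambda>N. \<Sum>j\<le>N. f j v * g (N - j) v) sums h v"
      using fs[OF v] gs[OF v] by (simp add: h_def sums_iff)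
  qed
  moreover have "dirichlet_integral l nu (\<lambda>v. \<Sum>j\<le>N. f j v * g (N - j) v) = gauss_coeff a b (l + nu) N * x ^ N" for N
  proof -
    let ?c = "\<lambda>j n. gauss_coeff (a - a') b l j * (pochhammer a' (N - j) / fact (N - j)) *
        (of_nat (N - j choose n) * (pochhammer (b - l) n / pochhammer nu n))"
    have "f j v * g (N - j) v = (\<Sum>n\<le>N - j. ?c j n * x ^ N * (of_real v ^ (j + (N - j - n)) * of_real (1 - v) ^ n))"
      if j: "j \<le> N" for j v
      unfolding f_def g_def sum_distrib_left
    proof (intro sum.cong refl)
      fix n assume "n \<in> {..N - j}"
      hence "x ^ N = x ^ j * x ^ n * x ^ (N - j - n)"
        using j by (simp flip: power_add)
      thus "gauss_coeff (a - a') b l j * (of_real v * x) ^ j * (pochhammer a' (N - j) / fact (N - j) *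
          (of_nat (N - j choose n) * q n * (of_real (1 - v) * x) ^ n * (of_real v * x) ^ (N - j - n))) =
        ?c j n * x ^ N * (of_real v ^ (j + (N - j - n)) * of_real (1 - v) ^ n)"
        by (simp add: q_def power_mult_distrib power_add del: of_real_diff)
    qed
    hence "dirichlet_integral l nu (\<lambda>v. \<Sum>j\<le>N. f j v * g (N - j) v) =
        dirichlet_integral l nu (\<lambda>v. \<Sum>j\<le>N. \<Sum>n\<le>N - j. ?c j n * x ^ N * (of_real v ^ (j + (N - j - n)) * of_real (1 - v) ^ n))"
      by (intro dirichlet_integral_cong sum.cong) auto
    \<comment> \<open>The triangular double sum is flattened to one finite index set so that
      linearity of the integral applies in a single step.\<close>
    also have "\<dots> = dirichlet_integral l nu (\<lambda>v. \<Sum>(j, n)\<in>(SIGMA j:{..N}. {..N - j}). ?c j n * x ^ N * (of_real v ^ (j + (N - j - n)) * of_real (1 - v) ^ n))"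
      by (subst sum.Sigma) auto
    also have "\<dots> = (\<Sum>(j, n)\<in>(SIGMA j:{..N}. {..N - j}). dirichlet_integral l nu (\<lambda>v. ?c j n * x ^ N * (of_real v ^ (j + (N - j - n)) * of_real (1 - v) ^ n)))"
      unfolding case_prod_unfold
    proof (rule dirichlet_integral_sum[OF l nu])
      fix p :: "nat \<times> nat" and v :: real
      assume v: "v \<in> {0<..<1}"
      have "norm (complex_of_real v ^ (fst p + (N - fst p - snd p)) * of_real (1 - v) ^ snd p) \<le> 1"
        using v by (auto simp: norm_mult norm_power simp del: of_real_diff intro!: mult_le_one power_le_one)
      from mult_left_mono[OF this norm_ge_zero[of "?c (fst p) (snd p) * x ^ N"]]
      show "norm (?c (fst p) (snd p) * x ^ N * (complex_of_real v ^ (fst p + (N - fst p - snd p)) * of_real (1 - v) ^ snd p)) \<le>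
          norm (?c (fst p) (snd p) * x ^ N)"
        by (simp only: norm_mult mult_1_right)
    qed measurable
    also have "\<dots> = (\<Sum>j\<le>N. \<Sum>n\<le>N - j. dirichlet_integral l nu (\<lambda>v. ?c j n * x ^ N * (of_real v ^ (j + (N - j - n)) * of_real (1 - v) ^ n)))"
      by (subst sum.Sigma) auto
    also have "\<dots> = (\<Sum>j\<le>N. \<Sum>n\<le>N - j. ?c j n * (pochhammer l (j + (N - j - n)) * pochhammer nu n / pochhammer (l + nu) (j + (N - j - n) + n)) * x ^ N)"
      unfolding dirichlet_integral_cmult dirichlet_integral_moment[OF l nu] by (simp only: mult_ac)
    also have "\<dots> = gauss_coeff a b (l + nu) N * x ^ N"
      unfolding sum_distrib_right[symmetric] Erdelyi_coefficient[OF l nu] ..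
    finally show ?thesis .
  qed
  ultimately have "(\<lambda>N. gauss_coeff a b (l + nu) N * x ^ N) sums dirichlet_integral l nu h"
    by simp
  moreover have "(\<lambda>N. gauss_coeff a b (l + nu) N * x ^ N) sums gauss_series a b (l + nu) x"
    using l nu x by (intro gauss_series_sums) auto
  ultimately show ?thesis
    unfolding h_def by (rule sums_unique2)
qed

section \<open>The Appell function\<close>

text \<open>Both arguments lie strictly between -\<pi>/2 and \<pi>/2, so the principal logarithms
  add without a branch correction.\<close>

lemma powr_mult_of_Re_pos:
  fixes p q e :: complex
  assumes "Re p > 0" "Re q > 0"
  shows "(p * q) powr e = p powr e * q powr e"
proof -
  have nz: "p \<noteq> 0" "q \<noteq> 0"
    using assms by auto
  have "\<bar>Im (Ln p)\<bar> < pi / 2" "\<bar>Im (Ln q)\<bar> < pi / 2"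
    using Re_Ln_pos_lt[of p] Re_Ln_pos_lt[of q] assms nz by blast+
  hence "Ln (p * q) = Ln p + Ln q"
    using nz by (intro Ln_times_simple) auto
  thus ?thesis
    using nz by (simp add: powr_def ring_distribs exp_add)
qed

text \<open>With x = y/(1-s) everything depends on v x, because 1 - s - v y = (1-s)(1 - v x). The
  factor (1 - v x)^(-a1) splits into exponents -(a1-a2), consumed by Pfaff's transformation, and
  -a2, which belongs to Erdelyi's integrand.\<close>

lemma Erdelyi_integral_scaled:
  fixes a1 a2 b1 c1 d1 y s :: complex
  assumes c1: "Re c1 > Re d1" and d1: "Re d1 > 0" and ys: "norm y + norm s < 1"
  shows "dirichlet_integral (c1 - d1) d1 (\<lambda>v.
      (1 - s - of_real v * y) powr (- a1)
      * hyp2F1 (a1 - a2) (c1 - b1 - d1) (c1 - d1) (of_real v * y / (of_real v * y + s - 1))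
      * hyp2F1 a2 (b1 + d1 - c1) d1 (of_real (1 - v) * y / (1 - of_real v * y - s))) =
    (1 - s) powr (- a1) * gauss_series a1 b1 c1 (y / (1 - s))"
proof -
  define l where "l = c1 - d1"
  have l: "Re l > 0"
    using c1 by (simp add: l_def)
  define x where "x = y / (1 - s)"
  have "norm y < 1 - norm s"
    using ys by simp
  also have "\<dots> \<le> norm (1 - s)"
    using norm_triangle_ineq2[of 1 s] by simp
  finally have ys': "norm y < norm (1 - s)" .
  hence x: "norm x < 1"
    by (simp add: x_def norm_divide divide_less_eq)
  have nz: "1 - s \<noteq> 0"
    using ys' by auto
  have y: "y = x * (1 - s)"
    using nz by (simp add: x_def)
  have Re_s: "Re (1 - s) > 0"
    using complex_Re_le_cmod[of s] norm_ge_zero[of y] ys unfolding minus_complex.sel one_complex.sel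
    by linarith
  have "(1 - s - of_real v * y) powr (- a1)
      * hyp2F1 (a1 - a2) (c1 - b1 - d1) (c1 - d1) (of_real v * y / (of_real v * y + s - 1))
      * hyp2F1 a2 (b1 + d1 - c1) d1 (of_real (1 - v) * y / (1 - of_real v * y - s)) =
    (1 - s) powr (- a1) * (gauss_series (a1 - a2) b1 l (of_real v * x) *
           ((1 - of_real v * x) powr (- a2) *
             gauss_series a2 (b1 - l) d1 (of_real (1 - v) * x / (1 - of_real v * x))))"
    if v: "0 < v" "v < 1" for v :: real
  proof -
    let ?u = "of_real v * x"
    have ux: "norm ?u \<le> norm x"
      using v by (simp add: norm_mult mult_left_le_one_le)
    hence u: "norm ?u < 1"
      using x by linarith
    hence Re_u: "Re (1 - ?u) > 0"
      using complex_Re_le_cmod[of ?u] unfolding minus_complex.sel one_complex.sel by linarith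
    have fac: "1 - s - of_real v * y = (1 - s) * (1 - ?u)"
      by (simp add: y algebra_simps)
    have arg1: "of_real v * y / (of_real v * y + s - 1) = ?u / (?u - 1)"
    proof -
      have 1: "of_real v * y + s - 1 = (?u - 1) * (1 - s)"
        by (simp add: y algebra_simps)
      have 2: "of_real v * y = ?u * (1 - s)"
        by (simp add: y)
      show ?thesis
        unfolding 1 unfolding 2 using nz by simp
    qed
    have arg2: "of_real (1 - v) * y / (1 - of_real v * y - s) = of_real (1 - v) * x / (1 - ?u)"
    proof -
      have 1: "1 - of_real v * y - s = (1 - ?u) * (1 - s)"
        by (simp add: y algebra_simps)
      have 2: "of_real (1 - v) * y = of_real (1 - v) * x * (1 - s)"
        by (simp add: y)
      show ?thesis
        unfolding 1 unfolding 2 using nz by simp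
    qed
    \<comment> \<open>The argument of the second hypergeometric function stays in the unit disc, so
      there \<open>hyp2F1\<close> is just the series.\<close>
    have "norm (of_real (1 - v) * x) < 1 - norm ?u"
    proof -
      have "norm (of_real (1 - v) * x) + norm ?u = norm x"
        using v by (simp add: norm_mult algebra_simps del: of_real_diff)
      thus ?thesis
        using x by simp
    qed
    also have "\<dots> \<le> norm (1 - ?u)"
      using norm_triangle_ineq2[of 1 ?u] by simp
    finally have lt: "norm (of_real (1 - v) * x / (1 - ?u)) < 1"
      by (simp add: norm_divide divide_less_eq del: of_real_diff)
    have split: "(1 - s - of_real v * y) powr (- a1) =
        (1 - s) powr (- a1) * ((1 - ?u) powr (- (a1 - a2)) * (1 - ?u) powr (- a2))"
      unfolding fac powr_mult_of_Re_pos[OF Re_s Re_u] by (simp flip: powr_add)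
    have pfaff: "(1 - ?u) powr (- (a1 - a2)) * hyp2F1 (a1 - a2) (c1 - b1 - d1) (c1 - d1) (?u / (?u - 1)) =
        gauss_series (a1 - a2) b1 l ?u"
      using Pfaff_transformation[OF l u, of "a1 - a2" b1] by (simp add: l_def algebra_simps)
    have disc: "hyp2F1 a2 (b1 + d1 - c1) d1 (of_real (1 - v) * x / (1 - ?u)) =
        gauss_series a2 (b1 - l) d1 (of_real (1 - v) * x / (1 - ?u))"
    proof -
      have "b1 + d1 - c1 = b1 - l"
        by (simp add: l_def)
      thus ?thesis
        by (simp only: hyp2F1_holomorphic_and_eq(2)[OF d1 lt])
    qed
    show ?thesis
      unfolding arg1 arg2 split disc pfaff[symmetric] by (simp only: mult_ac)
  qed
  hence "dirichlet_integral (c1 - d1) d1 (\<lambda>v.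
      (1 - s - of_real v * y) powr (- a1)
      * hyp2F1 (a1 - a2) (c1 - b1 - d1) (c1 - d1) (of_real v * y / (of_real v * y + s - 1))
      * hyp2F1 a2 (b1 + d1 - c1) d1 (of_real (1 - v) * y / (1 - of_real v * y - s))) =
    dirichlet_integral (c1 - d1) d1 (\<lambda>v. (1 - s) powr (- a1) * (gauss_series (a1 - a2) b1 l (of_real v * x) *
           ((1 - of_real v * x) powr (- a2) *
             gauss_series a2 (b1 - l) d1 (of_real (1 - v) * x / (1 - of_real v * x)))))"
    by (intro dirichlet_integral_cong)
  also have "\<dots> = (1 - s) powr (- a1) * gauss_series a1 b1 (l + d1) x"
    unfolding dirichlet_integral_cmult l_def[symmetric] Erdelyi_integral[OF l d1 x] ..
  finally show ?thesis
    by (simp add: l_def x_def)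
qed

text \<open>The double series in y and w z is summed by columns, that is, by powers of w z. Column n
  scales as w^n, so integrating over w inserts the moment (b')_n/(c')_n that completes the Appell
  coefficient.\<close>

theorem appell_F2_eq_dirichlet_integral:
  fixes a b b' c c' y z :: complex
  assumes c: "Re c > 0" and b': "Re b' > 0" and c': "Re c' > Re b'" and yz: "norm y + norm z < 1"
  shows "appell_F2 a b b' c c' y z =
    dirichlet_integral b' (c' - b') (\<lambda>w.
      (1 - of_real w * z) powr (- a) * gauss_series a b c (y / (1 - of_real w * z)))"
proof -
  define q where "q n = pochhammer b n / pochhammer c n" for n
  have q: "subexponential q"
    unfolding q_def by (rule subexponential_pochhammer_ratio[OF c])
  define q' where "q' n = pochhammer b' n / pochhammer c' n" for n
  have q': "subexponential q'"
    unfolding q'_def using b' c' by (intro subexponential_pochhammer_ratio) simp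
  let ?T = "binomial_double_term a q y z"
  have T_abs: "(\<lambda>p. norm (?T p)) summable_on UNIV"
    by (rule binomial_double_abs_summable[OF q yz])
  \<comment> \<open>\<open>E n\<close> already contains z^n / n!. The column sum of norms
    \<open>B n\<close> dominates w^n \<open>E n\<close> uniformly in w.\<close>
  define E where "E n = infsum (\<lambda>m. ?T (m, n)) UNIV" for n
  define B where "B n = infsum (\<lambda>m. norm (?T (m, n))) UNIV" for n
  have col: "(\<lambda>m. norm (?T (m, n))) summable_on UNIV" for n
    using summable_on_reindex[of "\<lambda>m. (m, n)" UNIV "\<lambda>p. norm (?T p)"]
      summable_on_subset_banach[OF T_abs, of "range (\<lambda>m. (m, n))"] by (simp add: inj_on_def o_def)
  have EB: "norm (E n) \<le> B n" for n
    unfolding E_def B_def by (rule norm_infsum_bound[OF col])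
  have B: "summable B"
    using sums_summable[OF infsum_columns_sums[OF T_abs]] unfolding B_def[abs_def] .
  have scale: "binomial_double_term a q y (e * z) (m, n) = e ^ n * ?T (m, n)" for e m n
    by (simp add: binomial_double_term_def power_mult_distrib)

  have "(\<lambda>n. dirichlet_integral b' (c' - b') (\<lambda>w. of_real w ^ n * E n)) sums
    dirichlet_integral b' (c' - b') (\<lambda>w.
      (1 - of_real w * z) powr (- a) * gauss_series a b c (y / (1 - of_real w * z)))"
  proof (rule dirichlet_integral_sums[OF _ _ _ _ B])
    fix w :: real assume w: "w \<in> {0<..<1}"
    show "norm (of_real w ^ n * E n) \<le> B n" for n
    proof -
      have "norm (of_real w ^ n * E n) \<le> 1 * norm (E n)"
        unfolding norm_mult using w by (intro mult_right_mono) (auto simp: norm_power power_le_one)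
      with EB[of n] show ?thesis by simp
    qed
    have "norm (of_real w * z) \<le> norm z"
      using w by (simp add: norm_mult mult_left_le_one_le)
    hence st: "norm y + norm (of_real w * z) < 1"
      using yz by linarith
    let ?I = "infsum (binomial_double_term a q y (of_real w * z)) UNIV"
    have "norm y < 1 - norm (of_real w * z)"
      using st by simp
    also have "\<dots> \<le> norm (1 - of_real w * z)"
      using norm_triangle_ineq2[of 1 "of_real w * z"] by simp
    finally have "norm (y / (1 - of_real w * z)) < 1"
      by (simp add: norm_divide divide_less_eq)
    hence "(\<lambda>n. (1 - of_real w * z) powr (- a) * (gauss_coeff a b c n * (y / (1 - of_real w * z)) ^ n)) sums
        ((1 - of_real w * z) powr (- a) * gauss_series a b c (y / (1 - of_real w * z)))"
      by (intro sums_mult gauss_series_sums c)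
    hence "(\<lambda>n. (1 - of_real w * z) powr (- a) * (pochhammer a n * q n / fact n * (y / (1 - of_real w * z)) ^ n)) sums
        ((1 - of_real w * z) powr (- a) * gauss_series a b c (y / (1 - of_real w * z)))"
      by (simp add: gauss_coeff_def q_def)
    from sums_unique2[OF this binomial_double_row_form[OF q st]]
    have I: "(1 - of_real w * z) powr (- a) * gauss_series a b c (y / (1 - of_real w * z)) = ?I" .
    have "(\<lambda>n. infsum (\<lambda>m. binomial_double_term a q y (of_real w * z) (m, n)) UNIV) sums ?I"
      using binomial_double_abs_summable[OF q st, of a]
      by (intro infsum_columns_sums) (simp add: abs_summable_summable)
    thus "(\<lambda>n. of_real w ^ n * E n) sums
        ((1 - of_real w * z) powr (- a) * gauss_series a b c (y / (1 - of_real w * z)))"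
      by (simp add: I scale E_def infsum_cmult_right')
  qed (use b' c' in auto)
  moreover have "dirichlet_integral b' (c' - b') (\<lambda>w. of_real w ^ n * E n) = q' n * E n" for n
  proof -
    have "dirichlet_integral b' (c' - b') (\<lambda>w. of_real w ^ n * E n) =
        dirichlet_integral b' (c' - b') (\<lambda>w. E n * (of_real w ^ n * of_real (1 - w) ^ 0))"
      by (simp add: mult.commute)
    also have "\<dots> = E n * q' n"
      unfolding dirichlet_integral_cmult
      by (subst dirichlet_integral_moment) (use b' c' in \<open>auto simp: q'_def\<close>)
    finally show ?thesis
      by (simp add: mult.commute)
  qed
  moreover have "(\<lambda>n. q' n * E n) sums appell_F2 a b b' c c' y z"
  proof -
    let ?S = "\<lambda>(m, n). q' n * ?T (m, n)"
    \<comment> \<open>Here the spare factor r > 1 enlarges z instead of y, because \<open>q'\<close>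
      is indexed by the power of z.\<close>
    obtain r where r: "r > 1" "r * norm z + norm y < 1"
      using ex_scaling_gt_1[of "norm z" "norm y"] yz by (auto simp: add.commute)
    obtain C where C: "C \<ge> 0" "\<And>n. norm (q' n) \<le> C * r ^ n"
      using subexponentialE[OF q' r(1)] by blast
    have "(\<lambda>p. norm (binomial_double_term a q y (of_real r * z) p)) summable_on UNIV"
      using r by (intro binomial_double_abs_summable q) (simp add: norm_mult add.commute)
    hence "(\<lambda>p. C * norm (binomial_double_term a q y (of_real r * z) p)) summable_on UNIV"
      by (rule summable_on_cmult_right)
    hence "(\<lambda>p. norm (?S p)) summable_on UNIV"
    proof (rule summable_on_comparison_test)
      fix p :: "nat \<times> nat"
      obtain m n where p: "p = (m, n)" by force
      have "norm (q' n) * norm (?T (m, n)) \<le> C * r ^ n * norm (?T (m, n))"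
        by (intro mult_right_mono C) auto
      thus "norm (?S p) \<le> C * norm (binomial_double_term a q y (of_real r * z) p)"
        using r by (simp add: p scale norm_mult norm_power mult.assoc)
    qed auto
    hence "?S summable_on UNIV"
      by (rule abs_summable_summable)
    from infsum_columns_sums[OF this]
    have "(\<lambda>n. q' n * E n) sums infsum ?S UNIV"
      by (simp add: E_def infsum_cmult_right')
    also have "infsum ?S UNIV = appell_F2 a b b' c c' y z"
      unfolding appell_F2_def
      by (intro infsum_cong) (auto simp: binomial_double_term_def q_def q'_def mult_ac)
    finally show ?thesis .
  qed
  ultimately show ?thesis
    using sums_unique2 by fastforce
qed

theorem theorem3p2:
  fixes a1 a2 b1 b2 c1 c2 d1 y z :: complex
  assumes "Re c1 > Re d1" and "Re d1 > 0"
    and "Re c2 > Re b2" and "Re b2 > 0"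
    and "norm y + norm z < 1"
  shows "appell_F2 a1 b1 b2 c1 c2 y z =
    dirichlet_integral b2 (c2 - b2) (\<lambda>w. dirichlet_integral (c1 - d1) d1 (\<lambda>v.
      (1 - of_real w * z - of_real v * y) powr (- a1)
      * hyp2F1 (a1 - a2) (c1 - b1 - d1) (c1 - d1)
          (of_real v * y / (of_real v * y + of_real w * z - 1))
      * hyp2F1 a2 (b1 + d1 - c1) d1
          (of_real (1 - v) * y / (1 - of_real v * y - of_real w * z))))"
proof -
  have "appell_F2 a1 b1 b2 c1 c2 y z = dirichlet_integral b2 (c2 - b2) (\<lambda>w.
      (1 - of_real w * z) powr (- a1) * gauss_series a1 b1 c1 (y / (1 - of_real w * z)))"
    using assms by (intro appell_F2_eq_dirichlet_integral) auto
  also have "\<dots> = dirichlet_integral b2 (c2 - b2) (\<lambda>w. dirichlet_integral (c1 - d1) d1 (\<lambda>v.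
      (1 - of_real w * z - of_real v * y) powr (- a1)
      * hyp2F1 (a1 - a2) (c1 - b1 - d1) (c1 - d1)
          (of_real v * y / (of_real v * y + of_real w * z - 1))
      * hyp2F1 a2 (b1 + d1 - c1) d1
          (of_real (1 - v) * y / (1 - of_real v * y - of_real w * z))))"
  \<comment> \<open>For each fixed w the inner integral is the scaled Erdelyi integral at s = w
    z.\<close>
  proof (intro dirichlet_integral_cong Erdelyi_integral_scaled[symmetric] assms)
    fix w :: real assume "0 < w" "w < 1"
    hence "norm (of_real w * z) \<le> norm z"
      by (simp add: norm_mult mult_left_le_one_le)
    thus "norm y + norm (of_real w * z) < 1"
      using assms(5) by linarith
  qed
  finally show ?thesis .
qed

end
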